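(* Let $n\ge 5$. The generic Darboux curve of degree $n$ in the complex projective plane has only finitely many inscribed complete $(n+1)$-gons.
   Context: A complete $m$-gon is the union of $m$ lines in $\mathbf{P}^2$ meeting in $\binom m2$ distinct points, called vertices. It is inscribed in a plane curve if the curve contains all its vertices. A Darboux curve of degree $n$ is a plane curve of degree $n$ that has an inscribed complete $(n+1)$-gon. *)

theory Defs
  imports "HOL-Analysis.Analysis" "HOL-Library.Poly_Mapping"
begin

text \<open>Complex polynomials in variables indexed by an arbitrary type, as finitely supported
  maps from exponent vectors to coefficients.\<close>

type_synonym 'v cpoly = "('v \<Rightarrow>\<^sub>0 nat) \<Rightarrow>\<^sub>0 complex"

definition cpoly_at :: "'v cpoly \<Rightarrow> ('v \<Rightarrow> complex) \<Rightarrow> complex" where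
  "cpoly_at p x =
     (\<Sum>m\<in>Poly_Mapping.keys p. Poly_Mapping.lookup p m *
        (\<Prod>v\<in>Poly_Mapping.keys m. x v ^ Poly_Mapping.lookup m v))"

definition homogeneous_of_degree :: "nat \<Rightarrow> 'v cpoly \<Rightarrow> bool" where
  "homogeneous_of_degree d p \<longleftrightarrow>
     (\<forall>m\<in>Poly_Mapping.keys p. (\<Sum>v\<in>Poly_Mapping.keys m. Poly_Mapping.lookup m v) = d)"

text \<open>A point of the projective plane is the set of all its homogeneous coordinate vectors.\<close>

type_synonym point = "(complex ^ 3) set"

definition proj_point :: "complex ^ 3 \<Rightarrow> point" where
  "proj_point v = {c *s v | c. c \<noteq> 0}"

definition proj_line :: "complex ^ 3 \<Rightarrow> point set" where
  "proj_line a = {proj_point v | v. v \<noteq> 0 \<and> (\<Sum>i\<in>UNIV. a $ i * v $ i) = 0}"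

definition proj_lines :: "point set set" where
  "proj_lines = {proj_line a | a. a \<noteq> 0}"

text \<open>A plane curve of degree \<open>n\<close> is a nonzero ternary form of degree \<open>n\<close> up to nonzero scalars
  (so it may be reducible or non-reduced), represented by the set of all its defining forms.\<close>

type_synonym curve = "3 cpoly set"

definition curve_of :: "3 cpoly \<Rightarrow> curve" where
  "curve_of F = {Poly_Mapping.map (\<lambda>a. c * a) F | c. c \<noteq> 0}"

definition plane_curves :: "nat \<Rightarrow> curve set" where
  "plane_curves n = {curve_of F | F. homogeneous_of_degree n F \<and> F \<noteq> 0}"

definition curve_points :: "curve \<Rightarrow> point set" where
  "curve_points C = {proj_point v | v F. v \<noteq> 0 \<and> F \<in> C \<and> cpoly_at F (\<lambda>i. v $ i) = 0}"

text \<open>The Zariski topology on the projective space of plane curves of degree \<open>n\<close>, generated by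
  the nonvanishing loci of homogeneous polynomials \<open>G\<close> in the coefficients of the form. The
  variables of \<open>G\<close> are indexed by all ternary exponent vectors; those not of degree \<open>n\<close> take the
  value 0 on forms of degree \<open>n\<close>.\<close>

definition zariski_curves :: "nat \<Rightarrow> curve topology" where
  "zariski_curves n = topology_generated_by
     {{curve_of F | F. homogeneous_of_degree n F \<and> F \<noteq> 0 \<and>
                       cpoly_at G (Poly_Mapping.lookup F) \<noteq> 0}
      | (d :: nat) (G :: (3 \<Rightarrow>\<^sub>0 nat) cpoly). homogeneous_of_degree d G}"

lemma topspace_zariski_curves: "topspace (zariski_curves n) = plane_curves n"
proof -
  have "homogeneous_of_degree 0 (1 :: (3 \<Rightarrow>\<^sub>0 nat) cpoly)"
    by (simp add: homogeneous_of_degree_def)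
  moreover have "cpoly_at (1 :: (3 \<Rightarrow>\<^sub>0 nat) cpoly) x \<noteq> 0" for x
    by (simp add: cpoly_at_def)
  ultimately show ?thesis
    unfolding zariski_curves_def topology_generated_by_topspace plane_curves_def by blast
qed

text \<open>A complete polygon, i.e. a union of lines, is represented by the set of these lines, which
  the union determines.\<close>

definition vertices :: "point set set \<Rightarrow> point set" where
  "vertices L = (\<Union>l\<in>L. \<Union>l'\<in>L - {l}. l \<inter> l')"

definition complete_polygon :: "nat \<Rightarrow> point set set \<Rightarrow> bool" where
  "complete_polygon m L \<longleftrightarrow>
     L \<subseteq> proj_lines \<and> finite L \<and> card L = m \<and> card (vertices L) = m choose 2"

definition inscribed :: "point set set \<Rightarrow> curve \<Rightarrow> bool" where
  "inscribed L C \<longleftrightarrow> vertices L \<subseteq> curve_points C"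

definition darboux_curves :: "nat \<Rightarrow> curve set" where
  "darboux_curves n = {C \<in> plane_curves n. \<exists>L. complete_polygon (n + 1) L \<and> inscribed L C}"

text \<open>A property holds for the generic point of a subset \<open>D\<close> of a space if it holds on a dense
  open subset of \<open>D\<close>.\<close>

definition holds_generically :: "'a topology \<Rightarrow> 'a set \<Rightarrow> ('a \<Rightarrow> bool) \<Rightarrow> bool" where
  "holds_generically T D P \<longleftrightarrow>
     (\<exists>U. openin (subtopology T D) U \<and> subtopology T D closure_of U = D \<and> (\<forall>x\<in>U. P x))"

end

theory Submission
  imports Defs
begin

text \<open>A curve of degree \<open>n\<close> passes through the vertices of the polygon with lines \<open>a\<^sub>0, \<dots>, a\<^sub>n\<close> iff its
  equation is \<open>\<Sum>i. c\<^sub>i \<Prod>j\<noteq>i. a\<^sub>j\<close>, so Darboux curves form the image of an irreducible parameter space.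
  Fixing one coordinate of each line leaves \<open>K = 3n + 3\<close> parameters. For \<open>n \<ge> 5\<close> the differential
  of the parametrization (with \<open>c = 1\<close>) is injective at a suitable polygon: a tangent vector \<open>m\<close> in its kernel
  satisfies \<open>(m\<^sub>i + m\<^sub>j)(a\<^sub>i \<inter> a\<^sub>j) = 0\<close> at all vertices, and for six suitable lines these 15 linear equations
  already make every \<open>m\<^sub>i\<close> proportional to \<open>a\<^sub>i\<close>. So there are \<open>K\<close> functionals of the curve that are
  algebraically independent on the family, whereas by counting monomials each parameter satisfies
  with them a nontrivial polynomial relation. Where the coefficients of these relations do
  not all vanish, every parameter takes finitely many values on the polygons inscribed in the
  curve. This also covers polygons with some \<open>c\<^sub>i = 0\<close>.\<close>

subsection \<open>Evaluation of polynomials\<close>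

text \<open>The number \<open>K\<close> is reached in two ways. If all scalars c_i are nonzero,
  rescaling the lines turns them into 1 (over the complex numbers the needed n-th root exists), so
  the slice c = 1 with all 3n + 3 line coordinates free already represents the generic form; the
  tangent computation takes place there. A polygon with some c_i = 0 escapes this slice. Finiteness
  is therefore proved in charts where one coordinate of each line is 1 and c_i occupies the freed
  slot: again \<open>K\<close> parameters, one chart for each choice of coordinates. In a chart the
  form has degree at most 1 in every single parameter, which is the degree control that replaces
  dimension theory in the counting. Irreducibility enters through lines only: two parameter values
  are joined by a line, on which finitely many nonzero polynomials have a common point of
  nonvanishing. The resulting condition on the coefficients need not be homogeneous, so it has to be
  split into homogeneous parts before it defines a Zariski open set of curves.\<close>

definition mono_at :: "('v \<Rightarrow>\<^sub>0 nat) \<Rightarrow> ('v \<Rightarrow> complex) \<Rightarrow> complex" where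
  "mono_at m x = (\<Prod>v\<in>Poly_Mapping.keys m. x v ^ Poly_Mapping.lookup m v)"

definition mono_deg :: "('v \<Rightarrow>\<^sub>0 nat) \<Rightarrow> nat" where
  "mono_deg m = (\<Sum>v\<in>Poly_Mapping.keys m. Poly_Mapping.lookup m v)"

lemma mono_at_superset:
  "finite S \<Longrightarrow> Poly_Mapping.keys m \<subseteq> S \<Longrightarrow> mono_at m x = (\<Prod>v\<in>S. x v ^ Poly_Mapping.lookup m v)"
  unfolding mono_at_def by (rule prod.mono_neutral_left) (auto simp: in_keys_iff)

lemma mono_deg_superset:
  "finite S \<Longrightarrow> Poly_Mapping.keys m \<subseteq> S \<Longrightarrow> mono_deg m = (\<Sum>v\<in>S. Poly_Mapping.lookup m v)"
  unfolding mono_deg_def by (rule sum.mono_neutral_left) (auto simp: in_keys_iff)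

lemma mono_at_add: "mono_at (m + m') x = mono_at m x * mono_at m' x"
proof -
  let ?S = "Poly_Mapping.keys m \<union> Poly_Mapping.keys m'"
  have "Poly_Mapping.keys (m + m') \<subseteq> ?S" by (rule keys_add)
  then show ?thesis
    by (simp add: mono_at_superset[of ?S] lookup_add power_add prod.distrib)
qed

lemma mono_deg_add: "mono_deg (m + m') = mono_deg m + mono_deg m'"
proof -
  let ?S = "Poly_Mapping.keys m \<union> Poly_Mapping.keys m'"
  have "Poly_Mapping.keys (m + m') \<subseteq> ?S" by (rule keys_add)
  then show ?thesis
    by (simp add: mono_deg_superset[of ?S] lookup_add sum.distrib)
qed

lemma mono_at_zero [simp]: "mono_at 0 x = 1"
  and mono_at_single [simp]: "mono_at (Poly_Mapping.single v k) x = x v ^ k"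
  and mono_deg_single [simp]: "mono_deg (Poly_Mapping.single v k) = k"
  by (simp_all add: mono_at_def mono_deg_def)

lemma cpoly_at_mono_at:
  "cpoly_at p x = (\<Sum>m\<in>Poly_Mapping.keys p. Poly_Mapping.lookup p m * mono_at m x)"
  by (simp add: cpoly_at_def mono_at_def)

lemma cpoly_at_superset:
  "finite S \<Longrightarrow> Poly_Mapping.keys p \<subseteq> S \<Longrightarrow>
    cpoly_at p x = (\<Sum>m\<in>S. Poly_Mapping.lookup p m * mono_at m x)"
  unfolding cpoly_at_mono_at by (rule sum.mono_neutral_left) (auto simp: in_keys_iff)

lemma cpoly_at_single [simp]: "cpoly_at (Poly_Mapping.single m c) x = c * mono_at m x"
  by (simp add: cpoly_at_mono_at)

lemma cpoly_at_zero [simp]: "cpoly_at 0 x = 0"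
  by (simp add: cpoly_at_def)

lemma cpoly_at_one [simp]: "cpoly_at 1 x = 1"
  by (simp add: cpoly_at_def)

lemma cpoly_at_add [simp]: "cpoly_at (p + q) x = cpoly_at p x + cpoly_at q x"
proof -
  let ?S = "Poly_Mapping.keys p \<union> Poly_Mapping.keys q"
  have "Poly_Mapping.keys (p + q) \<subseteq> ?S" by (rule keys_add)
  then show ?thesis
    by (simp add: cpoly_at_superset[of ?S] lookup_add sum.distrib algebra_simps)
qed

lemma cpoly_at_minus [simp]: "cpoly_at (- p) x = - cpoly_at p x"
  by (simp add: cpoly_at_mono_at sum_negf)

lemma cpoly_at_diff [simp]: "cpoly_at (p - q) x = cpoly_at p x - cpoly_at q x"
  using cpoly_at_add[of p "- q" x] by simp

lemma cpoly_at_sum [simp]: "cpoly_at (sum f A) x = (\<Sum>a\<in>A. cpoly_at (f a) x)"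
  by (induction A rule: infinite_finite_induct) auto

lemma cpoly_sum_monomials:
  "(p :: 'v cpoly) = (\<Sum>m\<in>Poly_Mapping.keys p. Poly_Mapping.single m (Poly_Mapping.lookup p m))"
proof (rule poly_mapping_eqI)
  fix k
  have "(\<Sum>m\<in>Poly_Mapping.keys p. (Poly_Mapping.lookup p m when m = k)) = Poly_Mapping.lookup p k"
    by (cases "k \<in> Poly_Mapping.keys p")
       (auto simp: when_def in_keys_iff if_distrib cong: if_cong)
  then show "Poly_Mapping.lookup p k = Poly_Mapping.lookup
      (\<Sum>m\<in>Poly_Mapping.keys p. Poly_Mapping.single m (Poly_Mapping.lookup p m)) k"
    by (simp add: lookup_sum lookup_single)
qed

lemma cpoly_at_mult [simp]: "cpoly_at (p * q) x = cpoly_at p x * cpoly_at q x"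
proof -
  have "p * q = (\<Sum>m\<in>Poly_Mapping.keys p. \<Sum>m'\<in>Poly_Mapping.keys q.
      Poly_Mapping.single (m + m') (Poly_Mapping.lookup p m * Poly_Mapping.lookup q m'))"
    by (subst cpoly_sum_monomials[of p], subst cpoly_sum_monomials[of q])
       (simp add: sum_product mult_single)
  then have "cpoly_at (p * q) x = (\<Sum>m\<in>Poly_Mapping.keys p. \<Sum>m'\<in>Poly_Mapping.keys q.
      (Poly_Mapping.lookup p m * mono_at m x) * (Poly_Mapping.lookup q m' * mono_at m' x))"
    by (simp add: mono_at_add mult_ac)
  then show ?thesis by (simp add: cpoly_at_mono_at sum_product)
qed

lemma cpoly_at_prod [simp]: "cpoly_at (prod f A) x = (\<Prod>a\<in>A. cpoly_at (f a) x)"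
  by (induction A rule: infinite_finite_induct) auto

definition cnst :: "complex \<Rightarrow> 'v cpoly" where
  "cnst c = Poly_Mapping.single 0 c"

lemma cpoly_at_cnst [simp]: "cpoly_at (cnst c) x = c"
  by (simp add: cnst_def)

lemma cnst_add: "cnst (c + d) = cnst c + cnst d"
  and cnst_mult: "cnst (c * d) = cnst c * cnst d"
  and cnst_one: "cnst 1 = 1"
  by (simp_all add: cnst_def single_add mult_single)

lemma cnst_power: "cnst (c ^ k) = cnst c ^ k"
  by (induction k) (simp_all add: cnst_mult cnst_one)

lemma map_eq_cnst_mult: "Poly_Mapping.map (\<lambda>a. c * a) p = cnst c * p"
  unfolding cnst_def by (rule mult_map_scale_conv_mult)

lemma lookup_cnst_mult [simp]: "Poly_Mapping.lookup (cnst c * p) m = c * Poly_Mapping.lookup p m"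
  unfolding map_eq_cnst_mult[symmetric] by (simp add: Poly_Mapping.map.rep_eq when_def)

section \<open>Homogeneous polynomials and scaling\<close>

lemma homogeneous_iff:
  "homogeneous_of_degree d p \<longleftrightarrow> (\<forall>m. Poly_Mapping.lookup p m \<noteq> 0 \<longrightarrow> mono_deg m = d)"
  by (auto simp: homogeneous_of_degree_def mono_deg_def in_keys_iff)

lemma homogeneous_zero: "homogeneous_of_degree d 0"
  and homogeneous_one: "homogeneous_of_degree 0 1"
  and homogeneous_cnst: "homogeneous_of_degree 0 (cnst c)"
  and homogeneous_single: "mono_deg m = d \<Longrightarrow> homogeneous_of_degree d (Poly_Mapping.single m c)"
  by (simp_all add: homogeneous_of_degree_def mono_deg_def cnst_def)

lemma homogeneous_add:
  "homogeneous_of_degree d p \<Longrightarrow> homogeneous_of_degree d q \<Longrightarrow> homogeneous_of_degree d (p + q)"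
  unfolding homogeneous_of_degree_def using keys_add[of p q] by blast

lemma homogeneous_diff:
  "homogeneous_of_degree d p \<Longrightarrow> homogeneous_of_degree d q \<Longrightarrow> homogeneous_of_degree d (p - q)"
  unfolding homogeneous_of_degree_def using keys_diff[of p q] by blast

lemma homogeneous_sum:
  "(\<And>i. i \<in> I \<Longrightarrow> homogeneous_of_degree d (f i)) \<Longrightarrow> homogeneous_of_degree d (sum f I)"
  by (induction I rule: infinite_finite_induct) (auto intro: homogeneous_add homogeneous_zero)

lemma homogeneous_mult:
  assumes "homogeneous_of_degree d p" "homogeneous_of_degree e q"
  shows "homogeneous_of_degree (d + e) (p * q)"
  unfolding homogeneous_of_degree_def mono_deg_def[symmetric]
proof
  fix m assume "m \<in> Poly_Mapping.keys (p * q)"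
  then obtain a b where "m = a + b" "a \<in> Poly_Mapping.keys p" "b \<in> Poly_Mapping.keys q"
    using keys_mult[of p q] by blast
  then show "mono_deg m = d + e"
    using assms by (simp add: mono_deg_add homogeneous_of_degree_def mono_deg_def[symmetric])
qed

lemma homogeneous_prod:
  assumes "\<And>i. i \<in> I \<Longrightarrow> homogeneous_of_degree 1 (f i)"
  shows "homogeneous_of_degree (card I) (prod f I)"
  using assms
proof (induction I rule: infinite_finite_induct)
  case (insert x F)
  then show ?case using homogeneous_mult[of 1 "f x" "card F" "prod f F"] by simp
qed (simp_all add: homogeneous_one)

lemma mono_at_scale: "mono_at m (\<lambda>v. t * x v) = t ^ mono_deg m * mono_at m x"
  by (simp add: mono_at_def mono_deg_def power_mult_distrib prod.distrib power_sum)

lemma cpoly_at_scale: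
  assumes "homogeneous_of_degree d p"
  shows "cpoly_at p (\<lambda>v. t * x v) = t ^ d * cpoly_at p x"
proof -
  have "mono_deg m = d" if "m \<in> Poly_Mapping.keys p" for m
    using assms that by (simp add: homogeneous_of_degree_def mono_deg_def)
  then show ?thesis
    by (simp add: cpoly_at_mono_at mono_at_scale sum_distrib_left mult_ac)
qed

text \<open>The lowest digit is split off by mod and div, twice. This recovers the exponents of a
  ternary monomial from the single exponent left by the substitution further below.\<close>

lemma base_expansion_unique:
  fixes D :: nat
  assumes "a0 + D * (a1 + D * a2) = b0 + D * (b1 + D * b2)"
    and "a0 < D" "a1 < D" "a2 < D" "b0 < D" "b1 < D" "b2 < D"
  shows "a0 = b0 \<and> a1 = b1 \<and> a2 = b2"
proof -
  have split: "u = u' \<and> w = w'" if "u + D * w = u' + D * w'" "u < D" "u' < D" for u w u' w'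
  proof -
    have "(u + D * w) mod D = u" "(u + D * w) div D = w" using that(2) by simp_all
    moreover have "(u' + D * w') mod D = u'" "(u' + D * w') div D = w'" using that(3) by simp_all
    ultimately show ?thesis by (metis that(1))
  qed
  from split[OF assms(1,2,5)] have "a0 = b0" "a1 + D * a2 = b1 + D * b2" by auto
  with split[OF this(2) assms(3,6)] show ?thesis by simp
qed

lemma ternary_exponent_eqI:
  assumes "Poly_Mapping.lookup m 1 = Poly_Mapping.lookup m' 1"
    "Poly_Mapping.lookup m 2 = Poly_Mapping.lookup m' 2"
    "Poly_Mapping.lookup m 3 = Poly_Mapping.lookup m' (3 :: 3)"
  shows "m = m'"
proof (rule poly_mapping_eqI)
  fix k :: 3 show "Poly_Mapping.lookup m k = Poly_Mapping.lookup m' k"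
    using exhaust_3[of k] assms by auto
qed

lemma mono_at_3:
  "mono_at m (x :: 3 \<Rightarrow> complex) = x 1 ^ Poly_Mapping.lookup m 1 * x 2 ^ Poly_Mapping.lookup m 2
     * x 3 ^ Poly_Mapping.lookup m 3"
proof -
  have "mono_at m x = (\<Prod>v\<in>UNIV. x v ^ Poly_Mapping.lookup m v)"
    by (rule mono_at_superset) auto
  also have "\<dots> = x 1 ^ Poly_Mapping.lookup m 1 * x 2 ^ Poly_Mapping.lookup m 2 * x 3 ^ Poly_Mapping.lookup m 3"
    unfolding UNIV_3 by (simp add: mult.assoc)
  finally show ?thesis .
qed

lemma mono_deg_3:
  "mono_deg (m :: 3 \<Rightarrow>\<^sub>0 nat) =
     Poly_Mapping.lookup m 1 + Poly_Mapping.lookup m 2 + Poly_Mapping.lookup m 3"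
  by (simp add: mono_deg_superset[of UNIV] sum_3)

lemma finite_ternary_monomials: "finite {m :: 3 \<Rightarrow>\<^sub>0 nat. mono_deg m = d}"
proof (rule inj_on_finite)
  let ?f = "\<lambda>m :: 3 \<Rightarrow>\<^sub>0 nat. (Poly_Mapping.lookup m 1, Poly_Mapping.lookup m 2, Poly_Mapping.lookup m 3)"
  show "inj_on ?f {m. mono_deg m = d}"
    by (rule inj_onI) (auto intro: ternary_exponent_eqI)
  show "?f ` {m. mono_deg m = d} \<subseteq> {..d} \<times> {..d} \<times> {..d}"
    by (auto simp: mono_deg_3)
qed simp

text \<open>Kronecker substitution \<open>(u, u\<^sup>D, u\<^bsup>D*D\<^esup>)\<close> separates the monomials.\<close>

lemma ternary_cpoly_eq_zero:
  fixes p :: "3 cpoly"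
  assumes "\<And>x. cpoly_at p x = 0"
  shows "p = 0"
proof (rule ccontr)
  assume "p \<noteq> 0"
  then obtain m0 where m0: "m0 \<in> Poly_Mapping.keys p" by (auto simp flip: keys_eq_empty)
  define D where "D = Suc (\<Sum>m\<in>Poly_Mapping.keys p. mono_deg m)"
  have bound: "Poly_Mapping.lookup m k < D" if "m \<in> Poly_Mapping.keys p" for m and k :: 3
  proof -
    have "mono_deg m \<le> (\<Sum>m\<in>Poly_Mapping.keys p. mono_deg m)"
      using that by (intro member_le_sum) auto
    then show ?thesis using exhaust_3[of k] by (auto simp: D_def mono_deg_3)
  qed
  define e where "e m = Poly_Mapping.lookup m 1 + D * (Poly_Mapping.lookup m 2
     + D * Poly_Mapping.lookup m (3 :: 3))" for m
  have inj: "e m = e m0 \<longleftrightarrow> m = m0" if "m \<in> Poly_Mapping.keys p" for m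
  proof
    assume "e m = e m0"
    from base_expansion_unique[OF this[unfolded e_def] bound[OF that] bound[OF that] bound[OF that]
        bound[OF m0] bound[OF m0] bound[OF m0]]
    show "m = m0" by (intro ternary_exponent_eqI) auto
  qed simp
  define q where "q = (\<Sum>m\<in>Poly_Mapping.keys p. monom (Poly_Mapping.lookup p m) (e m))"
  have "poly q u = 0" for u
  proof -
    define x where "x k = (if k = 1 then u else if k = 2 then u ^ D else u ^ (D * D))" for k :: 3
    have "u ^ e m = mono_at m x" for m
      by (simp add: mono_at_3 x_def e_def power_add power_mult distrib_left mult.assoc)
    then have "poly q u = cpoly_at p x"
      by (simp add: q_def poly_sum poly_monom cpoly_at_mono_at)
    then show ?thesis using assms by simp
  qed
  then have "q = 0" using poly_all_0_iff_0 by blast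
  moreover have "coeff q (e m0) = Poly_Mapping.lookup p m0"
    using m0 inj by (simp add: q_def coeff_sum sum.delta cong: sum.cong if_cong)
  ultimately show False using m0 by (simp add: in_keys_iff)
qed

section \<open>Curves as forms up to nonzero scalars\<close>

lemma curve_of_altdef: "curve_of F = {cnst c * F | c. c \<noteq> 0}"
  by (simp add: curve_of_def map_eq_cnst_mult)

lemma mem_curve_of: "F \<in> curve_of F"
  unfolding curve_of_altdef by (rule CollectI, rule exI[of _ 1]) (simp add: cnst_one)

lemma curve_of_cnst_mult: 
  assumes "c \<noteq> 0" shows "curve_of (cnst c * F) = curve_of F"
proof -
  have "\<exists>d'. d' \<noteq> 0 \<and> cnst d * (cnst c * F) = cnst d' * F" if "d \<noteq> 0" for d
    using assms that by (intro exI[of _ "d * c"]) (simp add: cnst_mult mult.assoc)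
  moreover have "\<exists>d'. d' \<noteq> 0 \<and> cnst d * F = cnst d' * (cnst c * F)" if "d \<noteq> 0" for d
    using assms that
    by (intro exI[of _ "d / c"]) (simp add: mult.assoc[symmetric] cnst_mult[symmetric])
  ultimately show ?thesis unfolding curve_of_altdef by blast
qed

lemma curve_of_eqD: "curve_of F = curve_of F' \<Longrightarrow> \<exists>c. c \<noteq> 0 \<and> F = cnst c * F'"
  using mem_curve_of[of F] unfolding curve_of_altdef by blast

subsection \<open>Polynomial functions\<close>

text \<open>Univariate polynomiality as a property of functions, so that any expression can be
  restricted to a line without symbolic bookkeeping. \<open>polyd\<close> keeps a degree bound for
  counting zeros; \<open>polyc\<close> serves where finiteness of the zero set is enough.\<close>

definition polyd :: "nat \<Rightarrow> (complex \<Rightarrow> complex) \<Rightarrow> bool" where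
  "polyd d f \<longleftrightarrow> (\<exists>p. degree p \<le> d \<and> (\<forall>s. f s = poly p s))"

definition polyc :: "(complex \<Rightarrow> complex) \<Rightarrow> bool" where
  "polyc f \<longleftrightarrow> (\<exists>p. \<forall>s. f s = poly p s)"

lemma polyd_polyc: "polyd d f \<Longrightarrow> polyc f"
  by (auto simp: polyd_def polyc_def)

lemma polyd_mono: "polyd d f \<Longrightarrow> d \<le> e \<Longrightarrow> polyd e f"
  unfolding polyd_def by (meson le_trans)

lemma polyd_const: "polyd 0 (\<lambda>s. c)"
  unfolding polyd_def by (rule exI[of _ "[:c:]"]) simp

lemma polyd_ident: "polyd 1 (\<lambda>s. s)"
  unfolding polyd_def by (rule exI[of _ "[:0, 1:]"]) simp

lemma polyd_add:
  assumes "polyd d f" "polyd d g" shows "polyd d (\<lambda>s. f s + g s)"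
proof -
  obtain p q where "degree p \<le> d" "degree q \<le> d" "\<forall>s. f s = poly p s" "\<forall>s. g s = poly q s"
    using assms unfolding polyd_def by auto
  then show ?thesis
    unfolding polyd_def by (intro exI[of _ "p + q"]) (auto intro: degree_add_le)
qed

lemma polyd_mult:
  assumes "polyd d f" "polyd e g" shows "polyd (d + e) (\<lambda>s. f s * g s)"
proof -
  obtain p q where "degree p \<le> d" "degree q \<le> e" "\<forall>s. f s = poly p s" "\<forall>s. g s = poly q s"
    using assms unfolding polyd_def by auto
  then show ?thesis
    unfolding polyd_def
    by (intro exI[of _ "p * q"]) (auto intro: order_trans[OF degree_mult_le] add_mono)
qed

lemma polyd_cmult: "polyd d f \<Longrightarrow> polyd d (\<lambda>s. c * f s)"
  using polyd_mult[OF polyd_const] by simp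

lemma polyd_sum: "(\<And>i. i \<in> I \<Longrightarrow> polyd d (f i)) \<Longrightarrow> polyd d (\<lambda>s. \<Sum>i\<in>I. f i s)"
  by (induction I rule: infinite_finite_induct)
     (auto intro: polyd_add polyd_mono[OF polyd_const])

lemma polyd_prod:
  "(\<And>i. i \<in> I \<Longrightarrow> polyd (d i) (f i)) \<Longrightarrow> polyd (sum d I) (\<lambda>s. \<Prod>i\<in>I. f i s)"
  by (induction I rule: infinite_finite_induct) (auto intro: polyd_mult polyd_const)

lemma polyd_power: "polyd d f \<Longrightarrow> polyd (k * d) (\<lambda>s. f s ^ k)"
  by (induction k) (auto intro: polyd_mult polyd_const)

lemma polyd_affine: "polyd 1 (\<lambda>s. a + s * b)"
  unfolding polyd_def by (rule exI[of _ "[:a, b:]"]) simp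

lemma polyd_eq_zero:
  assumes "polyd d f" "finite S" "card S > d" "\<And>s. s \<in> S \<Longrightarrow> f s = 0"
  shows "f s = 0"
proof -
  obtain p where p: "degree p \<le> d" "\<And>s. f s = poly p s"
    using assms(1) unfolding polyd_def by auto
  have "p = 0"
  proof (rule ccontr)
    assume "p \<noteq> 0"
    then have "card {s. poly p s = 0} \<le> d" "finite {s. poly p s = 0}"
      using card_poly_roots_bound[of p] p(1) poly_roots_finite by auto
    moreover have "S \<subseteq> {s. poly p s = 0}" using assms(4) p(2) by auto
    ultimately show False using card_mono assms(3) by (metis leD le_trans)
  qed
  then show ?thesis using p by simp
qed

lemma polyc_const: "polyc (\<lambda>s. c)"
  and polyc_ident: "polyc (\<lambda>s. s)"
  using polyd_polyc polyd_const polyd_ident by blast+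

lemma polyc_affine: "polyc (\<lambda>s. a + s * b)"
  using polyd_polyc polyd_affine by blast

lemma polyc_add: "polyc f \<Longrightarrow> polyc g \<Longrightarrow> polyc (\<lambda>s. f s + g s)"
  unfolding polyc_def by (metis poly_add)

lemma polyc_diff: "polyc f \<Longrightarrow> polyc g \<Longrightarrow> polyc (\<lambda>s. f s - g s)"
  unfolding polyc_def by (metis poly_diff)

lemma polyc_mult: "polyc f \<Longrightarrow> polyc g \<Longrightarrow> polyc (\<lambda>s. f s * g s)"
  unfolding polyc_def by (metis poly_mult)

lemma polyc_sum: "(\<And>i. i \<in> I \<Longrightarrow> polyc (f i)) \<Longrightarrow> polyc (\<lambda>s. \<Sum>i\<in>I. f i s)"
  by (induction I rule: infinite_finite_induct) (auto intro: polyc_add polyc_const)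

lemma polyc_prod: "(\<And>i. i \<in> I \<Longrightarrow> polyc (f i)) \<Longrightarrow> polyc (\<lambda>s. \<Prod>i\<in>I. f i s)"
  by (induction I rule: infinite_finite_induct) (auto intro: polyc_mult polyc_const)

lemma polyc_power: "polyc f \<Longrightarrow> polyc (\<lambda>s. f s ^ k)"
  by (induction k) (auto intro: polyc_mult polyc_const)

lemma polyc_finite_zeros: "polyc f \<Longrightarrow> f s0 \<noteq> 0 \<Longrightarrow> finite {s. f s = 0}"
  unfolding polyc_def using poly_roots_finite by (metis (mono_tags, lifting) Collect_cong poly_0)

text \<open>Each zero set is finite and the complex line is not. Irreducibility is always used in
  this form.\<close>

lemma polyc_common_nonzero:
  assumes "finite I" "\<And>i. i \<in> I \<Longrightarrow> polyc (f i)" "\<And>i. i \<in> I \<Longrightarrow> \<exists>s. f i s \<noteq> 0" "finite Z"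
  shows "\<exists>s. s \<notin> Z \<and> (\<forall>i\<in>I. f i s \<noteq> 0)"
proof -
  have "finite {s. f i s = 0}" if "i \<in> I" for i
    using that assms polyc_finite_zeros by blast
  then have "finite (Z \<union> (\<Union>i\<in>I. {s. f i s = 0}))" using assms by blast
  then obtain s where "s \<notin> Z \<union> (\<Union>i\<in>I. {s. f i s = 0})"
    using ex_new_if_finite infinite_UNIV_char_0 by blast
  then show ?thesis by auto
qed

text \<open>Polynomial functions by closure rules, because substitution and restriction to lines are
  then plain inductions. The variables may be infinite in number, as with coefficients indexed by
  all ternary exponents.\<close>

inductive polyfun :: "(('v \<Rightarrow> complex) \<Rightarrow> complex) \<Rightarrow> bool" where
  polyfun_const: "polyfun (\<lambda>x. c)"
| polyfun_var: "polyfun (\<lambda>x. x v)"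
| polyfun_add: "polyfun f \<Longrightarrow> polyfun g \<Longrightarrow> polyfun (\<lambda>x. f x + g x)"
| polyfun_mult: "polyfun f \<Longrightarrow> polyfun g \<Longrightarrow> polyfun (\<lambda>x. f x * g x)"

lemma polyfun_sum: "(\<And>i. i \<in> I \<Longrightarrow> polyfun (f i)) \<Longrightarrow> polyfun (\<lambda>x. \<Sum>i\<in>I. f i x)"
  by (induction I rule: infinite_finite_induct) (auto intro: polyfun.intros)

lemma polyfun_prod: "(\<And>i. i \<in> I \<Longrightarrow> polyfun (f i)) \<Longrightarrow> polyfun (\<lambda>x. \<Prod>i\<in>I. f i x)"
  by (induction I rule: infinite_finite_induct) (auto intro: polyfun.intros)

lemma polyfun_power: "polyfun f \<Longrightarrow> polyfun (\<lambda>x. f x ^ k)"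
  by (induction k) (auto intro: polyfun.intros)

lemma polyfun_cpoly_at: "polyfun (cpoly_at G)"
  unfolding cpoly_at_def by (intro polyfun_sum polyfun_mult polyfun_prod polyfun_power polyfun.intros)

lemma polyfun_compose:
  assumes "polyfun f" "\<And>v. polyfun (g v)"
  shows "polyfun (\<lambda>x. f (\<lambda>v. g v x))"
  using assms(1) by induction (auto intro: polyfun.intros assms(2))

lemma polyfun_polyc:
  assumes "polyfun f" "\<And>v. polyc (\<lambda>s. g s v)"
  shows "polyc (\<lambda>s. f (g s))"
  using assms(1) by induction (auto intro: assms(2) polyc_const polyc_add polyc_mult)

lemma polyfun_imp_cpoly: "polyfun f \<Longrightarrow> \<exists>G. f = cpoly_at G"
proof (induction rule: polyfun.induct)
  case (polyfun_const c)
  show ?case by (intro exI[of _ "cnst c"] ext) simp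
next
  case (polyfun_var v)
  show ?case by (intro exI[of _ "Poly_Mapping.single (Poly_Mapping.single v 1) 1"] ext) simp
next
  case (polyfun_add f g)
  then obtain F G where "f = cpoly_at F" "g = cpoly_at G" by auto
  then show ?case by (intro exI[of _ "F + G"] ext) simp
next
  case (polyfun_mult f g)
  then obtain F G where "f = cpoly_at F" "g = cpoly_at G" by auto
  then show ?case by (intro exI[of _ "F * G"] ext) simp
qed

text \<open>Needed twice: for the lowest-order term at a point, and because the Zariski topology is
  generated by homogeneous polynomials.\<close>

lemma polyfun_homogeneous_parts:
  assumes "polyfun f"
  shows "\<exists>N G. (\<forall>r. homogeneous_of_degree r (G r)) \<and> (\<forall>x. f x = (\<Sum>r\<le>N. cpoly_at (G r) x))"
proof -
  obtain P where P: "f = cpoly_at P" using polyfun_imp_cpoly[OF assms] by blast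
  let ?K = "Poly_Mapping.keys P"
  \<comment> \<open>Any degree bound would do; the sum also makes sense for an empty set of
    monomials.\<close>
  define N where "N = (\<Sum>m\<in>?K. mono_deg m)"
  define G where "G r = (\<Sum>m | m \<in> ?K \<and> mono_deg m = r. Poly_Mapping.single m (Poly_Mapping.lookup P m))" for r
  have "homogeneous_of_degree r (G r)" for r
    unfolding G_def by (intro homogeneous_sum homogeneous_single) auto
  moreover have "f x = (\<Sum>r\<le>N. cpoly_at (G r) x)" for x
  proof -
    have "mono_deg ` ?K \<subseteq> {..N}" unfolding N_def by (auto intro: member_le_sum)
    then have "(\<Sum>r\<le>N. \<Sum>m | m \<in> ?K \<and> mono_deg m = r. Poly_Mapping.lookup P m * mono_at m x)
      = (\<Sum>m\<in>?K. Poly_Mapping.lookup P m * mono_at m x)"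
      by (intro sum.group) auto
    then show ?thesis by (simp add: P G_def cpoly_at_mono_at[of P])
  qed
  ultimately show ?thesis by blast
qed

text \<open>Both functions are restricted to the line joining \<open>x\<close> and \<open>y\<close>,
  where neither vanishes identically.\<close>

lemma polyfun_mult_nonzero:
  assumes "polyfun f" "polyfun g" "f x \<noteq> 0" "g y \<noteq> 0"
  shows "\<exists>z. f z * g z \<noteq> 0"
proof -
  let ?l = "\<lambda>s v. x v + s * (y v - x v)"
  have "\<exists>s. s \<notin> {} \<and> (\<forall>h\<in>{f, g}. h (?l s) \<noteq> 0)"
  proof (rule polyc_common_nonzero)
    fix h assume h: "h \<in> {f, g}"
    have "polyfun h" using h assms(1,2) by auto
    then show "polyc (\<lambda>s. h (?l s))" by (rule polyfun_polyc) (rule polyc_affine)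
    have "?l 0 = x" "?l 1 = y" by auto
    then show "\<exists>s. h (?l s) \<noteq> 0" using h assms(3,4) by (metis empty_iff insert_iff)
  qed auto
  then show ?thesis by auto
qed

lemma polyfun_prod_nonzero:
  assumes "finite I" "\<And>i. i \<in> I \<Longrightarrow> polyfun (f i)" "\<And>i. i \<in> I \<Longrightarrow> \<exists>x. f i x \<noteq> 0"
  shows "\<exists>x. (\<Prod>i\<in>I. f i x) \<noteq> 0"
  using assms
proof (induction I rule: finite_induct)
  case (insert i I)
  then obtain x y where "f i x \<noteq> 0" "(\<Prod>i\<in>I. f i y) \<noteq> 0" by (metis insertCI)
  then have "\<exists>z. f i z * (\<Prod>i\<in>I. f i z) \<noteq> 0"
    using insert.prems by (intro polyfun_mult_nonzero[of "f i" "\<lambda>z. \<Prod>i\<in>I. f i z" x y] polyfun_prod) auto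
  then show ?case using insert.hyps by simp
qed simp

subsection \<open>Algebraic dependence by counting\<close>

text \<open>Gaussian elimination, one equation per induction step, with unknowns indexed by
  \<open>E\<close> and equations by \<open>G\<close>.\<close>

lemma underdetermined_system:
  fixes \<phi> :: "'e \<Rightarrow> 'g \<Rightarrow> complex"
  assumes "finite G" "finite E" "card G < card E"
  shows "\<exists>b. (\<exists>e\<in>E. b e \<noteq> 0) \<and> (\<forall>g\<in>G. (\<Sum>e\<in>E. b e * \<phi> e g) = 0)"
  using assms
proof (induction G arbitrary: E \<phi> rule: finite_induct)
  case empty
  then have "E \<noteq> {}" by auto
  then show ?case by (intro exI[of _ "\<lambda>_. 1"]) auto
next
  case (insert g G)
  show ?case
  proof (cases "\<forall>e\<in>E. \<phi> e g = 0")
    case True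
    then show ?thesis using insert.IH[of E \<phi>] insert.prems insert.hyps by auto
  next
    case False
    then obtain e0 where e0: "e0 \<in> E" "\<phi> e0 g \<noteq> 0" by blast
    \<comment> \<open>The pivot \<open>e0\<close> clears equation \<open>g\<close> from all other
      columns.\<close>
    define \<psi> where "\<psi> e h = \<phi> e h - \<phi> e g / \<phi> e0 g * \<phi> e0 h" for e h
    have "card G < card (E - {e0})" "finite (E - {e0})"
      using insert.prems insert.hyps e0 by auto
    then obtain b where b: "\<exists>e\<in>E - {e0}. b e \<noteq> 0" "\<forall>h\<in>G. (\<Sum>e\<in>E - {e0}. b e * \<psi> e h) = 0"
      using insert.IH[of "E - {e0}" \<psi>] by blast
    \<comment> \<open>The value at \<open>e0\<close> is the one forced by equation
      \<open>g\<close>.\<close>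
    define b' where "b' = b(e0 := - (\<Sum>e\<in>E - {e0}. b e * (\<phi> e g / \<phi> e0 g)))"
    have eq: "(\<Sum>e\<in>E. b' e * \<phi> e h) = (\<Sum>e\<in>E - {e0}. b e * \<psi> e h)" for h
    proof -
      have "(\<Sum>e\<in>E. b' e * \<phi> e h) = b' e0 * \<phi> e0 h + (\<Sum>e\<in>E - {e0}. b e * \<phi> e h)"
        using e0 insert.prems by (subst sum.remove[of _ e0]) (auto simp: b'_def)
      also have "\<dots> = (\<Sum>e\<in>E - {e0}. b e * \<psi> e h)"
        by (simp add: b'_def \<psi>_def right_diff_distrib sum_subtractf sum_distrib_right mult.assoc)
      finally show ?thesis .
    qed
    have "\<psi> e g = 0" for e using e0 by (simp add: \<psi>_def)
    then have "\<forall>h\<in>insert g G. (\<Sum>e\<in>E. b' e * \<phi> e h) = 0" using b(2) eq by auto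
    moreover have "\<exists>e\<in>E. b' e \<noteq> 0" using b(1) by (auto simp: b'_def)
    ultimately show ?thesis by blast
  qed
qed

text \<open>Coordinates leave the grid one at a time: with the first \<open>r\<close> already
  arbitrary, coordinate \<open>r\<close> offers more than \<open>d\<close> zeros to a polynomial of
  degree at most \<open>d\<close>.\<close>

lemma vanishes_on_grid:
  fixes f :: "(nat \<Rightarrow> complex) \<Rightarrow> complex"
  assumes deg: "\<And>x j. polyd d (\<lambda>s. f (x(j := s)))"
    and dep: "\<And>x y. (\<forall>j<K. x j = y j) \<Longrightarrow> f x = f y"
    and S: "finite S" "card S > d"
    and zero: "\<And>x. (\<forall>j<K. x j \<in> S) \<Longrightarrow> f x = 0"
  shows "f x = 0"
proof -
  have "r \<le> K \<Longrightarrow> \<forall>x. (\<forall>j. r \<le> j \<and> j < K \<longrightarrow> x j \<in> S) \<longrightarrow> f x = 0" for r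
  proof (induction r)
    case 0
    then show ?case using zero by auto
  next
    case (Suc r)
    show ?case
    proof (intro allI impI)
      fix x assume x: "\<forall>j. Suc r \<le> j \<and> j < K \<longrightarrow> x j \<in> S"
      have "f (x(r := s)) = 0" if "s \<in> S" for s
      proof -
        have "\<forall>j. r \<le> j \<and> j < K \<longrightarrow> (x(r := s)) j \<in> S" using x that by auto
        then show ?thesis using Suc by auto
      qed
      from polyd_eq_zero[OF deg S this, of "x r"] show "f x = 0" by simp
    qed
  qed
  from this[of K] show ?thesis by (meson leD order_refl)
qed

text \<open>A number below \<open>d ^ K\<close> encodes an exponent vector with \<open>K\<close>
  entries below \<open>d\<close> by its digits. The induction removes the lowest digit.\<close>

lemma sum_base_digits:
  fixes d :: nat
  shows "e < d ^ K \<Longrightarrow> (\<Sum>j<K. d ^ j * (e div d ^ j mod d)) = e"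
proof (induction K arbitrary: e)
  case (Suc K)
  have d: "d > 0" using Suc.prems by (cases d) auto
  have "(\<Sum>j<Suc K. d ^ j * (e div d ^ j mod d))
      = e mod d + (\<Sum>j<K. d ^ Suc j * (e div d ^ Suc j mod d))"
    by (subst sum.lessThan_Suc_shift) simp
  also have "(\<Sum>j<K. d ^ Suc j * (e div d ^ Suc j mod d))
      = d * (\<Sum>j<K. d ^ j * ((e div d) div d ^ j mod d))"
    by (simp add: sum_distrib_left mult.assoc div_mult2_eq)
  also have "(\<Sum>j<K. d ^ j * ((e div d) div d ^ j mod d)) = e div d"
    using Suc.prems d by (intro Suc.IH) (simp add: less_mult_imp_div_less mult.commute)
  finally show ?case by simp
qed simp

text \<open>Substituting \<open>u ^ d ^ j\<close> for the j-th variable turns the monomial with code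
  \<open>e\<close> into \<open>u ^ e\<close>, so no two monomials merge.\<close>

lemma digit_polynomial_nonzero:
  fixes b :: "nat \<Rightarrow> complex"
  assumes "e0 < d ^ K" "b e0 \<noteq> 0"
  shows "\<exists>y. (\<Sum>e<d ^ K. b e * (\<Prod>j<K. y j ^ (e div d ^ j mod d))) \<noteq> 0"
proof (rule ccontr)
  assume neg: "\<not> ?thesis"
  define q where "q = (\<Sum>e<d ^ K. monom (b e) e)"
  have "poly q u = 0" for u
  proof -
    have "(\<Prod>j<K. (u ^ d ^ j) ^ (e div d ^ j mod d)) = u ^ e" if "e < d ^ K" for e
      using sum_base_digits[OF that] by (simp add: power_mult[symmetric] power_sum[symmetric])
    then have "poly q u = (\<Sum>e<d ^ K. b e * (\<Prod>j<K. (u ^ d ^ j) ^ (e div d ^ j mod d)))"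
      by (simp add: q_def poly_sum poly_monom)
    then show ?thesis using neg by auto
  qed
  then have "q = 0" using poly_all_0_iff_0 by blast
  moreover have "coeff q e0 = b e0" using assms by (simp add: q_def coeff_sum)
  ultimately show False using assms by simp
qed

text \<open>The \<open>d\<^bsup>K+1\<^esup>\<close> monomials in \<open>t, y\<^sub>0, \<dots>, y\<^bsub>K-1\<^esub>\<close> with exponents below \<open>d\<close> have degree at most
  \<open>d (K + 1)\<close> in each of the \<open>K\<close> variables, so for large \<open>d\<close> they are linearly dependent.\<close>

lemma algebraic_relation:
  fixes t :: "(nat \<Rightarrow> complex) \<Rightarrow> complex" and y :: "nat \<Rightarrow> (nat \<Rightarrow> complex) \<Rightarrow> complex"
  assumes t: "\<And>x i. polyd 1 (\<lambda>s. t (x(i := s)))"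
    and y: "\<And>j x i. polyd 1 (\<lambda>s. y j (x(i := s)))"
    and dep_t: "\<And>x x'. (\<forall>i<K. x i = x' i) \<Longrightarrow> t x = t x'"
    and dep_y: "\<And>j x x'. (\<forall>i<K. x i = x' i) \<Longrightarrow> y j x = y j x'"
  shows "\<exists>P. polyfun P \<and> (\<forall>Y Y'. (\<forall>j<K. Y j = Y' j) \<longrightarrow> P Y = P Y') \<and> (\<exists>Y. P Y \<noteq> 0) \<and>
    (\<forall>Y. P Y \<noteq> 0 \<longrightarrow> finite {t x | x. \<forall>j<K. y j x = Y j})"
proof -
  \<comment> \<open>Chosen so that \<open>(d * (K + 2)) ^ K < d ^ (K + 1)\<close>: fewer grid points
    than monomials.\<close>
  define d where "d = (K + 2) ^ K + 1"
  define mn where "mn Y e = (\<Prod>j<K. Y j ^ (e div d ^ j mod d))" for Y :: "nat \<Rightarrow> complex" and e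
  define \<phi> where "\<phi> e x = t x ^ fst e * mn (\<lambda>j. y j x) (snd e)" for e x
  define E where "E = {..<d} \<times> {..<d ^ K}"
  \<comment> \<open>One more point per coordinate than the degree bound, so vanishing on the grid
    implies vanishing everywhere.\<close>
  define S where "S = (of_nat :: nat \<Rightarrow> complex) ` {..d * (K + 1)}"
  define G where "G = PiE {..<K} (\<lambda>_. S)"
  have d: "d > 0" and dK: "(K + 2) ^ K < d" by (simp_all add: d_def)
  have S: "finite S" "card S = d * (K + 1) + 1"
    by (auto simp: S_def card_image inj_on_def)
  have "card G = (d * (K + 1) + 1) ^ K" by (simp add: G_def card_PiE S)
  also have "\<dots> \<le> (d * (K + 2)) ^ K" using d by (intro power_mono) auto
  also have "\<dots> = d ^ K * (K + 2) ^ K" by (rule power_mult_distrib)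
  also have "\<dots> < d ^ K * d" using d dK by simp
  also have "\<dots> = card E" by (simp add: E_def)
  finally have "card G < card E" .
  moreover have "finite G" "finite E" using S by (auto simp: G_def E_def intro: finite_PiE)
  ultimately obtain b where b: "\<exists>e\<in>E. b e \<noteq> 0" "\<forall>g\<in>G. (\<Sum>e\<in>E. b e * \<phi> e g) = 0"
    using underdetermined_system[of G E \<phi>] by blast
  have rel: "(\<Sum>e\<in>E. b e * \<phi> e x) = 0" for x
  proof (rule vanishes_on_grid[where f = "\<lambda>x. \<Sum>e\<in>E. b e * \<phi> e x" and d = "d * (K + 1)" and K = K and S = S])
    fix x j
    have "polyd (d * (K + 1)) (\<lambda>s. \<phi> e (x(j := s)))" if "e \<in> E" for e
    proof -
      have "polyd (fst e * 1 + (\<Sum>i<K. (snd e div d ^ i mod d) * 1)) (\<lambda>s. \<phi> e (x(j := s)))"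
        unfolding \<phi>_def mn_def
        by (intro polyd_mult polyd_power polyd_prod t y)
      moreover have "(\<Sum>i<K. snd e div d ^ i mod d) \<le> (\<Sum>i<K. d)"
        using d by (intro sum_mono) (simp add: less_imp_le)
      ultimately show ?thesis using that by (elim polyd_mono) (auto simp: E_def algebra_simps)
    qed
    then show "polyd (d * (K + 1)) (\<lambda>s. \<Sum>e\<in>E. b e * \<phi> e (x(j := s)))"
      by (intro polyd_sum polyd_cmult)
  next
    fix x x' :: "nat \<Rightarrow> complex" assume x: "\<forall>j<K. x j = x' j"
    show "(\<Sum>e\<in>E. b e * \<phi> e x) = (\<Sum>e\<in>E. b e * \<phi> e x')"
      using dep_t[OF x] dep_y[OF x] by (simp add: \<phi>_def)
  next
    fix x :: "nat \<Rightarrow> complex" assume x: "\<forall>j<K. x j \<in> S"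
    \<comment> \<open>Elements of \<open>G\<close> are \<open>undefined\<close> from
      \<open>K\<close> on; only the first \<open>K\<close> values influence \<open>t\<close> and
      \<open>y\<close>.\<close>
    have "restrict x {..<K} \<in> G" using x by (auto simp: G_def)
    then have "(\<Sum>e\<in>E. b e * \<phi> e (restrict x {..<K})) = 0" using b by blast
    moreover have "\<phi> e (restrict x {..<K}) = \<phi> e x" for e
      using dep_t[of "restrict x {..<K}" x] dep_y[of "restrict x {..<K}" x] by (simp add: \<phi>_def)
    ultimately show "(\<Sum>e\<in>E. b e * \<phi> e x) = 0" by simp
  qed (use S in auto)
  \<comment> \<open>\<open>Q k\<close> is the coefficient of the k-th power of \<open>t\<close> in
    the relation. Where one such coefficient is nonzero, all values of \<open>t\<close> on the fibre
    are roots of one nonzero polynomial. The case k = 0 is allowed.\<close>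
  define Q where "Q k Y = (\<Sum>e<d ^ K. b (k, e) * mn Y e)" for k Y
  obtain k e0 where k: "k < d" "e0 < d ^ K" "b (k, e0) \<noteq> 0" using b(1) by (auto simp: E_def)
  have "polyfun (Q k)"
    unfolding Q_def mn_def by (intro polyfun_sum polyfun_mult polyfun_prod polyfun_power polyfun.intros)
  moreover have dep: "Q i Y = Q i Y'" if "\<forall>j<K. Y j = Y' j" for i Y Y'
    using that by (simp add: Q_def mn_def)
  moreover have "\<exists>Y. Q k Y \<noteq> 0"
    unfolding Q_def mn_def using digit_polynomial_nonzero[of e0 d K "\<lambda>e. b (k, e)"] k by auto
  moreover have "finite {t x | x. \<forall>j<K. y j x = Y j}" if nz: "Q k Y \<noteq> 0" for Y
  proof -
    define p where "p = (\<Sum>i<d. monom (Q i Y) i)"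
    have "coeff p k = Q k Y" using k by (simp add: p_def coeff_sum)
    then have "p \<noteq> 0" using nz by auto
    then have "finite {s. poly p s = 0}" by (rule poly_roots_finite)
    moreover have "poly p (t x) = 0" if "\<forall>j<K. y j x = Y j" for x
    proof -
      have "(\<Sum>e\<in>E. b e * \<phi> e x) = (\<Sum>i<d. \<Sum>e<d ^ K. b (i, e) * \<phi> (i, e) x)"
        unfolding E_def by (simp add: sum.cartesian_product case_prod_beta)
      also have "\<dots> = (\<Sum>i<d. Q i (\<lambda>j. y j x) * t x ^ i)"
        by (simp add: Q_def \<phi>_def sum_distrib_left sum_distrib_right mult_ac)
      also have "\<dots> = poly p (t x)"
        using dep[OF that] by (simp add: p_def poly_sum poly_monom)
      finally show ?thesis using rel by simp
    qed
    ultimately show ?thesis by (elim finite_subset[rotated]) auto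
  qed
  ultimately show ?thesis by (intro exI[of _ "Q k"]) auto
qed

subsection \<open>Combinations of evaluations\<close>

text \<open>Finite combinations of point evaluations act on arbitrary functions, so no vector space
  of forms is needed, and they preserve polynomial dependence on parameters.\<close>

inductive eval_comb :: "(('a \<Rightarrow> complex) \<Rightarrow> complex) \<Rightarrow> bool" where
  eval_comb_eval: "eval_comb (\<lambda>h. h x)"
| eval_comb_zero: "eval_comb (\<lambda>h. 0)"
| eval_comb_add: "eval_comb L \<Longrightarrow> eval_comb M \<Longrightarrow> eval_comb (\<lambda>h. L h + M h)"
| eval_comb_scale: "eval_comb L \<Longrightarrow> eval_comb (\<lambda>h. c * L h)"

lemma eval_comb_sum: "(\<And>i. i \<in> I \<Longrightarrow> eval_comb (L i)) \<Longrightarrow> eval_comb (\<lambda>h. \<Sum>i\<in>I. L i h)"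
  by (induction I rule: infinite_finite_induct) (auto intro: eval_comb.intros)

lemma eval_comb_diff: "eval_comb L \<Longrightarrow> eval_comb M \<Longrightarrow> eval_comb (\<lambda>h. L h - M h)"
  using eval_comb_add[OF _ eval_comb_scale[of M "- 1"], of L] by simp

lemma eval_comb_linear:
  "eval_comb L \<Longrightarrow> L (\<lambda>x. \<Sum>k\<in>I. c k * f k x) = (\<Sum>k\<in>I. c k * L (f k))"
  by (induction rule: eval_comb.induct)
     (simp_all add: sum.distrib distrib_left sum_distrib_left mult_ac)

lemma eval_comb_polyfun:
  "eval_comb L \<Longrightarrow> (\<And>x. polyfun (\<lambda>c. h c x)) \<Longrightarrow> polyfun (\<lambda>c. L (h c))"
  by (induction rule: eval_comb.induct) (auto intro: polyfun.intros)

lemma eval_comb_polyd: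
  "eval_comb L \<Longrightarrow> (\<And>x. polyd d (\<lambda>s. h s x)) \<Longrightarrow> polyd d (\<lambda>s. L (h s))"
  by (induction rule: eval_comb.induct)
     (auto intro: polyd_add polyd_cmult polyd_mono[OF polyd_const])

text \<open>Inductive step: subtracting from \<open>f K\<close> its components along the earlier
  functions leaves some \<open>g\<close>, which by independence is nonzero at a point
  \<open>x0\<close>. Evaluation there supplies the new functional.\<close>

lemma dual_functionals:
  fixes f :: "nat \<Rightarrow> 'a \<Rightarrow> complex"
  assumes "\<And>c. (\<And>x. (\<Sum>i<K. c i * f i x) = 0) \<Longrightarrow> \<forall>i<K. c i = 0"
  shows "\<exists>L. (\<forall>j. eval_comb (L j)) \<and> (\<forall>i<K. \<forall>j<K. L j (f i) = (if i = j then 1 else 0))"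
  using assms
proof (induction K)
  case 0
  show ?case by (intro exI[of _ "\<lambda>_ _. 0"]) (auto intro: eval_comb.intros)
next
  case (Suc K)
  have indep: "\<forall>i<K. c i = 0" if z: "\<And>x. (\<Sum>i<K. c i * f i x) = 0" for c
  proof -
    let ?c = "c(K := 0)"
    have "(\<Sum>i<Suc K. ?c i * f i x) = 0" for x using z[of x] by simp
    from Suc.prems[OF this] show ?thesis by (metis fun_upd_apply less_Suc_eq nat_neq_iff)
  qed
  then obtain L where L: "\<And>j. eval_comb (L j)"
    "\<And>i j. i < K \<Longrightarrow> j < K \<Longrightarrow> L j (f i) = (if i = j then 1 else 0)"
    using Suc.IH[OF indep] by blast
  define g where "g x = f K x - (\<Sum>i<K. L i (f K) * f i x)" for x
  obtain x0 where x0: "g x0 \<noteq> 0"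
  proof (rule ccontr)
    assume "\<not> thesis"
    then have g0: "g x = 0" for x using that by blast
    let ?c = "\<lambda>i. if i = K then 1 else - L i (f K)"
    have "(\<Sum>i<Suc K. ?c i * f i x) = 0" for x
      using g0[of x] by (simp add: g_def sum_negf)
    from Suc.prems[OF this] show False by (metis lessI one_neq_zero)
  qed
  \<comment> \<open>Evaluation at \<open>x0\<close>, corrected to kill the earlier functions and
    normalized to be 1 on \<open>f K\<close>.\<close>
  define M where "M h = (1 / g x0) * (h x0 - (\<Sum>i<K. f i x0 * L i h))" for h
  have evM: "eval_comb M"
    unfolding M_def
    by (intro eval_comb_scale eval_comb_diff eval_comb_eval eval_comb_sum L)
  have M: "M (f i) = (if i = K then 1 else 0)" if "i < Suc K" for i
  proof (cases "i = K")
    case True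
    then show ?thesis using x0 by (simp add: M_def g_def mult.commute)
  next
    case False
    then have "i < K" using that by simp
    then have "(\<Sum>j<K. f j x0 * L j (f i)) = f i x0"
      by (simp add: L if_distrib[of "\<lambda>z. _ * z"] cong: if_cong)
    then show ?thesis using False by (simp add: M_def)
  qed
  \<comment> \<open>The old functionals are corrected by \<open>M\<close> so that they vanish on
    \<open>f K\<close>.\<close>
  define L' where "L' j = (if j = K then M else (\<lambda>h. L j h - L j (f K) * M h))" for j
  have "eval_comb (L' j)" for j
    using evM by (auto simp: L'_def intro: eval_comb_diff eval_comb_scale L)
  moreover have "L' j (f i) = (if i = j then 1 else 0)" if "i < Suc K" "j < Suc K" for i j
    using that M[of i] L(2)[of i j] by (auto simp: L'_def)
  ultimately show ?case by (intro exI[of _ L']) blast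
qed

subsection \<open>Lines and points in general position\<close>

text \<open>Bilinear, without conjugation: its vanishing is incidence of a line and a point.\<close>

definition dotc :: "complex ^ 3 \<Rightarrow> complex ^ 3 \<Rightarrow> complex" where
  "dotc a v = (\<Sum>i\<in>UNIV. a $ i * v $ i)"

definition crossc :: "complex ^ 3 \<Rightarrow> complex ^ 3 \<Rightarrow> complex ^ 3" where
  "crossc a b = vector [a $ 2 * b $ 3 - a $ 3 * b $ 2, a $ 3 * b $ 1 - a $ 1 * b $ 3,
     a $ 1 * b $ 2 - a $ 2 * b $ 1]"

definition det3 :: "complex ^ 3 \<Rightarrow> complex ^ 3 \<Rightarrow> complex ^ 3 \<Rightarrow> complex" where
  "det3 a b c = dotc a (crossc b c)"

text \<open>Geometrically: no three of the lines are concurrent. For n >= 2 this also makes the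
  vectors nonzero and the lines distinct.\<close>

definition gen_pos :: "nat \<Rightarrow> (nat \<Rightarrow> complex ^ 3) \<Rightarrow> bool" where
  "gen_pos n a \<longleftrightarrow> (\<forall>i\<le>n. \<forall>j\<le>n. \<forall>k\<le>n. i \<noteq> j \<and> j \<noteq> k \<and> i \<noteq> k \<longrightarrow> det3 (a i) (a j) (a k) \<noteq> 0)"

lemma dotc_3: "dotc a v = a $ 1 * v $ 1 + a $ 2 * v $ 2 + a $ 3 * v $ 3"
  by (simp add: dotc_def sum_3)

lemma crossc_nth [simp]:
  "crossc a b $ 1 = a $ 2 * b $ 3 - a $ 3 * b $ 2"
  "crossc a b $ 2 = a $ 3 * b $ 1 - a $ 1 * b $ 3"
  "crossc a b $ 3 = a $ 1 * b $ 2 - a $ 2 * b $ 1"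
  by (simp_all add: crossc_def)

lemma dotc_add [simp]: "dotc a (u + v) = dotc a u + dotc a v"
  and dotc_diff [simp]: "dotc a (u - v) = dotc a u - dotc a v"
  and dotc_scale [simp]: "dotc a (c *s v) = c * dotc a v"
  and dotc_zero [simp]: "dotc a 0 = 0"
  and dotc_add_left [simp]: "dotc (a + b) v = dotc a v + dotc b v"
  and dotc_diff_left [simp]: "dotc (a - b) v = dotc a v - dotc b v"
  and dotc_scale_left [simp]: "dotc (c *s a) v = c * dotc a v"
  by (simp_all add: dotc_3 algebra_simps)

lemma dotc_crossc [simp]: "dotc a (crossc a b) = 0" "dotc b (crossc a b) = 0"
  by (simp_all add: dotc_3 algebra_simps)

text \<open>Cramer's rule, written as a polynomial identity.\<close>

lemma det3_orthogonal:
  assumes "det3 a b c \<noteq> 0" "dotc a x = 0" "dotc b x = 0" "dotc c x = 0"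
  shows "x = 0"
proof -
  have "det3 a b c *s x
      = dotc a x *s crossc b c + dotc b x *s crossc c a + dotc c x *s crossc a b"
    by (simp add: vec_eq_iff forall_3 det3_def dotc_3 algebra_simps)
  then show ?thesis using assms by simp
qed

text \<open>By the expansion of the triple cross product, \<open>x\<close> has zero cross product
  with \<open>crossc a b\<close>, hence is parallel to it.\<close>

lemma orthogonal_crossc:
  assumes "dotc a x = 0" "dotc b x = 0" "crossc a b \<noteq> 0"
  shows "\<exists>t. x = t *s crossc a b"
proof -
  let ?p = "crossc a b"
  have "crossc x ?p = dotc b x *s a - dotc a x *s b"
    by (simp add: vec_eq_iff forall_3 dotc_3 algebra_simps)
  then have "crossc x ?p = 0" using assms by simp
  then have c: "x $ 2 * ?p $ 3 = x $ 3 * ?p $ 2" "x $ 3 * ?p $ 1 = x $ 1 * ?p $ 3"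
      "x $ 1 * ?p $ 2 = x $ 2 * ?p $ 1"
    unfolding vec_eq_iff forall_3 crossc_nth(1)[of x] crossc_nth(2)[of x] crossc_nth(3)[of x] by auto
  then have sym: "x $ i * ?p $ j = x $ j * ?p $ i" for i j
    using exhaust_3[of i] exhaust_3[of j] by (elim disjE) (simp_all del: crossc_nth)
  obtain k where k: "?p $ k \<noteq> 0" using assms(3) by (auto simp: vec_eq_iff)
  have "x = (x $ k / ?p $ k) *s ?p"
    using sym[of _ k] k by (simp add: vec_eq_iff field_simps del: crossc_nth)
  then show ?thesis by blast
qed

lemma crossc_eq_zero:
  assumes "crossc a b = 0" "a \<noteq> 0"
  shows "\<exists>t. b = t *s a"
proof -
  have c: "a $ 2 * b $ 3 = a $ 3 * b $ 2" "a $ 3 * b $ 1 = a $ 1 * b $ 3"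
      "a $ 1 * b $ 2 = a $ 2 * b $ 1"
    using assms(1) unfolding vec_eq_iff forall_3 crossc_nth by auto
  then have sym: "a $ i * b $ j = a $ j * b $ i" for i j
    using exhaust_3[of i] exhaust_3[of j] by (elim disjE) simp_all
  obtain k where k: "a $ k \<noteq> 0" using assms(2) by (auto simp: vec_eq_iff)
  have "b = (b $ k / a $ k) *s a"
    using sym[of k] k by (simp add: vec_eq_iff field_simps)
  then show ?thesis by blast
qed

text \<open>The curve (1, s, s^2) lies in no plane through the origin, so each condition excludes
  only finitely many \<open>s\<close>.\<close>

lemma dotc_nonzero_exists:
  assumes "finite I" "\<And>i. i \<in> I \<Longrightarrow> b i \<noteq> 0"
  shows "\<exists>w. \<forall>i\<in>I. dotc (b i) w \<noteq> 0"
proof -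
  let ?w = "\<lambda>s. vector [1, s, s ^ 2] :: complex ^ 3"
  have eq: "dotc (b i) (?w s) = poly [:b i $ 1, b i $ 2, b i $ 3:] s" for i s
    by (simp add: dotc_3 algebra_simps power2_eq_square)
  have "\<exists>s. s \<notin> {} \<and> (\<forall>i\<in>I. dotc (b i) (?w s) \<noteq> 0)"
  proof (rule polyc_common_nonzero)
    fix i assume i: "i \<in> I"
    show "polyc (\<lambda>s. dotc (b i) (?w s))" unfolding polyc_def eq by blast
    have "[:b i $ 1, b i $ 2, b i $ 3:] \<noteq> 0"
      using assms(2)[OF i] by (auto simp: vec_eq_iff forall_3)
    then show "\<exists>s. dotc (b i) (?w s) \<noteq> 0" unfolding eq using poly_all_0_iff_0 by blast
  qed (use assms in auto)
  then show ?thesis by auto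
qed

lemma gen_pos_det3:
  "gen_pos n a \<Longrightarrow> i \<le> n \<Longrightarrow> j \<le> n \<Longrightarrow> k \<le> n \<Longrightarrow> i \<noteq> j \<Longrightarrow> j \<noteq> k \<Longrightarrow> i \<noteq> k \<Longrightarrow>
    det3 (a i) (a j) (a k) \<noteq> 0"
  by (auto simp: gen_pos_def)

lemma gen_pos_vertex:
  "gen_pos n a \<Longrightarrow> i \<le> n \<Longrightarrow> j \<le> n \<Longrightarrow> k \<le> n \<Longrightarrow> i \<noteq> j \<Longrightarrow> j \<noteq> k \<Longrightarrow> i \<noteq> k \<Longrightarrow>
    dotc (a k) (crossc (a i) (a j)) \<noteq> 0"
  using gen_pos_det3[of n a k i j] by (simp add: det3_def)

lemma third_index: "n \<ge> 2 \<Longrightarrow> \<exists>k\<le>n. k \<noteq> i \<and> k \<noteq> (j :: nat)"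
proof -
  assume "n \<ge> 2"
  then have "card {..n} > card {i, j}" by (auto simp: card_insert_if)
  then have "\<not> {..n} \<subseteq> {i, j}" by (metis card_mono finite.emptyI finite.insertI leD)
  then show ?thesis by auto
qed

lemma gen_pos_crossc_nonzero:
  assumes "gen_pos n a" "n \<ge> 2" "i \<le> n" "j \<le> n" "i \<noteq> j"
  shows "crossc (a i) (a j) \<noteq> 0"
proof -
  obtain k where "k \<le> n" "k \<noteq> i" "k \<noteq> j" using third_index assms(2) by blast
  then have "dotc (a k) (crossc (a i) (a j)) \<noteq> 0" using assms by (intro gen_pos_vertex) auto
  then show ?thesis by auto
qed

lemma gen_pos_nonzero: 
  assumes "gen_pos n a" "n \<ge> 2" "i \<le> n" shows "a i \<noteq> 0"
proof -
  obtain j where "j \<le> n" "j \<noteq> i" using third_index assms(2) by blast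
  then have "crossc (a i) (a j) \<noteq> 0" using assms by (intro gen_pos_crossc_nonzero) auto
  then show ?thesis by (auto simp: vec_eq_iff forall_3)
qed

text \<open>Supplies two points that span line \<open>i\<close> and are not vertices. Then
  \<open>q\<close> can normalize the scalar \<open>c i\<close>, and every vertex has a finite
  nonzero parameter on \<open>q + s *s w\<close>.\<close>

lemma points_on_line:
  assumes gp: "gen_pos n a" and n: "n \<ge> 2" and i: "i \<le> n" 
  shows "\<exists>q w. dotc (a i) q = 0 \<and> dotc (a i) w = 0 \<and>
    (\<forall>j\<le>n. j \<noteq> i \<longrightarrow> dotc (a j) q \<noteq> 0 \<and> dotc (a j) w \<noteq> 0) \<and>
    (\<forall>s. q + s *s w \<noteq> 0) \<and> (\<forall>x. dotc (a i) x = 0 \<longrightarrow> (\<exists>\<alpha> \<beta>. x = \<alpha> *s q + \<beta> *s w))"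
proof -
  obtain j where j: "j \<le> n" "j \<noteq> i" using third_index n by blast
  obtain k where k: "k \<le> n" "k \<noteq> i" "k \<noteq> j" using third_index n by blast
  \<comment> \<open>Two vertices of line \<open>i\<close> form a first basis; \<open>q\<close> and
    \<open>w\<close> are generic combinations of them.\<close>
  define u where "u = crossc (a i) (a j)"
  define v where "v = crossc (a i) (a k)"
  have uv: "dotc (a i) u = 0" "dotc (a i) v = 0" "dotc (a j) u = 0" "dotc (a k) v = 0"
    by (simp_all add: u_def v_def)
  have B: "dotc (a k) u \<noteq> 0"
    unfolding u_def using i j k by (intro gen_pos_vertex[OF gp]) auto
  have A: "dotc (a j) v \<noteq> 0"
    unfolding v_def using i j k by (intro gen_pos_vertex[OF gp]) auto
  have ex: "\<exists>s. s \<notin> Z \<and> (\<forall>l\<in>{..n} - {i}. dotc (a l) u + s * dotc (a l) v \<noteq> 0)"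
    if "finite Z" for Z :: "complex set"
  proof (rule polyc_common_nonzero)
    fix l assume l: "l \<in> {..n} - {i}"
    show "polyc (\<lambda>s. dotc (a l) u + s * dotc (a l) v)" by (rule polyc_affine)
    show "\<exists>s. dotc (a l) u + s * dotc (a l) v \<noteq> 0"
    proof (cases "l = j")
      case True
      then show ?thesis using A by (intro exI[of _ 1]) (simp add: uv)
    next
      case False
      then have "dotc (a l) u \<noteq> 0"
        unfolding u_def using i j l by (intro gen_pos_vertex[OF gp]) auto
      then show ?thesis by (intro exI[of _ 0]) simp
    qed
  qed (use that in auto)
  obtain s1 where s1: "\<forall>l\<in>{..n} - {i}. dotc (a l) u + s1 * dotc (a l) v \<noteq> 0"
    using ex[of "{}"] by auto
  obtain s2 where s2: "s2 \<noteq> s1" "\<forall>l\<in>{..n} - {i}. dotc (a l) u + s2 * dotc (a l) v \<noteq> 0"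
    using ex[of "{s1}"] by auto
  define q where "q = u + s1 *s v"
  define w where "w = u + s2 *s v"
  have "q + s *s w \<noteq> 0" for s
  proof
    assume z: "q + s *s w = 0"
    have "dotc (a k) (q + s *s w) = (1 + s) * dotc (a k) u"
      by (simp add: q_def w_def uv algebra_simps)
    then have "s = - 1" using z B by (simp add: add_eq_0_iff)
    moreover have "dotc (a j) (q + s *s w) = (s1 + s * s2) * dotc (a j) v"
      by (simp add: q_def w_def uv algebra_simps)
    ultimately show False using z A s2(1) by simp
  qed
  moreover have "\<exists>\<alpha> \<beta>. x = \<alpha> *s q + \<beta> *s w" if x: "dotc (a i) x = 0" for x
  proof -
    \<comment> \<open>In the basis \<open>u\<close>, \<open>v\<close> the vector is
      \<open>Y *s u + X *s v\<close>; \<open>\<alpha>\<close> and \<open>\<beta>\<close> solve the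
      resulting 2 by 2 system.\<close>
    define X where "X = dotc (a j) x / dotc (a j) v"
    define Y where "Y = dotc (a k) x / dotc (a k) u"
    define \<alpha> where "\<alpha> = (X - s2 * Y) / (s1 - s2)"
    define \<beta> where "\<beta> = (s1 * Y - X) / (s1 - s2)"
    have s12: "s1 - s2 \<noteq> 0" using s2 by simp
    have "\<alpha> + \<beta> = (s1 - s2) * Y / (s1 - s2)"
      unfolding \<alpha>_def \<beta>_def add_divide_distrib[symmetric] by (simp add: algebra_simps)
    then have e1: "\<alpha> + \<beta> = Y" using s12 by simp
    have "\<alpha> * s1 + \<beta> * s2 = (s1 - s2) * X / (s1 - s2)"
      unfolding \<alpha>_def \<beta>_def times_divide_eq_left add_divide_distrib[symmetric] by (simp add: algebra_simps)
    then have e2: "\<alpha> * s1 + \<beta> * s2 = X" using s12 by simp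
    have "x - (\<alpha> *s q + \<beta> *s w) = 0"
    proof (rule det3_orthogonal)
      show "det3 (a i) (a j) (a k) \<noteq> 0" using i j k by (intro gen_pos_det3[OF gp]) auto
      show "dotc (a i) (x - (\<alpha> *s q + \<beta> *s w)) = 0" using x by (simp add: q_def w_def uv)
      have "dotc (a j) (\<alpha> *s q + \<beta> *s w) = (\<alpha> * s1 + \<beta> * s2) * dotc (a j) v"
        by (simp add: q_def w_def uv algebra_simps)
      then show "dotc (a j) (x - (\<alpha> *s q + \<beta> *s w)) = 0" using A by (simp add: e2 X_def)
      have "dotc (a k) (\<alpha> *s q + \<beta> *s w) = (\<alpha> + \<beta>) * dotc (a k) u"
        by (simp add: q_def w_def uv algebra_simps)
      then show "dotc (a k) (x - (\<alpha> *s q + \<beta> *s w)) = 0" using B by (simp add: e1 Y_def)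
    qed
    then show ?thesis by auto
  qed
  moreover have "dotc (a i) q = 0" "dotc (a i) w = 0" by (simp_all add: q_def w_def uv)
  moreover have "dotc (a l) q \<noteq> 0 \<and> dotc (a l) w \<noteq> 0" if "l \<le> n" "l \<noteq> i" for l
    using s1 s2 that by (simp add: q_def w_def)
  ultimately show ?thesis by blast
qed

subsection \<open>Forms vanishing at the vertices of a complete polygon\<close>

definition lform :: "complex ^ 3 \<Rightarrow> 3 cpoly" where
  "lform a = (\<Sum>i\<in>UNIV. cnst (a $ i) * Poly_Mapping.single (Poly_Mapping.single i 1) 1)"

definition dform :: "nat \<Rightarrow> (nat \<Rightarrow> complex ^ 3) \<Rightarrow> (nat \<Rightarrow> complex) \<Rightarrow> 3 cpoly" where
  "dform n a c = (\<Sum>i\<le>n. cnst (c i) * (\<Prod>j\<in>{..n} - {i}. lform (a j)))"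

lemma cpoly_at_lform [simp]: "cpoly_at (lform a) (($) v) = dotc a v"
  by (simp add: lform_def dotc_def)

lemma cpoly_at_dform:
  "cpoly_at (dform n a c) (($) v) = (\<Sum>i\<le>n. c i * (\<Prod>j\<in>{..n} - {i}. dotc (a j) v))"
  by (simp add: dform_def)

lemma homogeneous_lform: "homogeneous_of_degree 1 (lform a)"
  unfolding lform_def
proof (rule homogeneous_sum)
  fix i
  show "homogeneous_of_degree 1 (cnst (a $ i) * Poly_Mapping.single (Poly_Mapping.single i 1) 1)"
    using homogeneous_mult[OF homogeneous_cnst[of "a $ i"]
        homogeneous_single[OF mono_deg_single[of i 1], of 1]] by simp
qed

lemma homogeneous_dform: "homogeneous_of_degree n (dform n a c)"
  unfolding dform_def
proof (intro homogeneous_sum)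
  fix i assume i: "i \<in> {..n}"
  have "homogeneous_of_degree (0 + card ({..n} - {i})) (cnst (c i) * (\<Prod>j\<in>{..n} - {i}. lform (a j)))"
    by (intro homogeneous_mult homogeneous_cnst homogeneous_prod homogeneous_lform)
  then show "homogeneous_of_degree n (cnst (c i) * (\<Prod>j\<in>{..n} - {i}. lform (a j)))"
    using i by simp
qed

text \<open>All summands but the i-th contain the factor \<open>a i\<close>.\<close>

lemma dform_at_line:
  assumes "i \<le> n" "dotc (a i) v = 0"
  shows "cpoly_at (dform n a c) (($) v) = c i * (\<Prod>j\<in>{..n} - {i}. dotc (a j) v)"
proof -
  have "(\<Prod>j\<in>{..n} - {k}. dotc (a j) v) = 0" if "k \<noteq> i" for k
    using assms that by (intro prod_zero) auto
  then have "(\<Sum>k\<le>n. c k * (\<Prod>j\<in>{..n} - {k}. dotc (a j) v))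
      = (\<Sum>k\<le>n. if k = i then c i * (\<Prod>j\<in>{..n} - {i}. dotc (a j) v) else 0)"
    by (intro sum.cong) auto
  then show ?thesis using assms(1) by (simp add: cpoly_at_dform)
qed

lemma dform_at_vertex:
  assumes "i \<le> n" "j \<le> n" "i \<noteq> j" "dotc (a i) v = 0" "dotc (a j) v = 0"
  shows "cpoly_at (dform n a c) (($) v) = 0"
proof -
  have "(\<Prod>k\<in>{..n} - {i}. dotc (a k) v) = 0" using assms by (intro prod_zero) auto
  then show ?thesis using dform_at_line[of i n a v c] assms by simp
qed

lemma homogeneous_at_scale:
  fixes F :: "3 cpoly"
  assumes "homogeneous_of_degree n F"
  shows "cpoly_at F (($) (t *s v)) = t ^ n * cpoly_at F (($) v)"
proof -
  have "($) (t *s v) = (\<lambda>i. t * v $ i)" by (simp add: fun_eq_iff)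
  then show ?thesis using cpoly_at_scale[OF assms, of t "($) v"] by simp
qed

lemma cpoly_at_line_polyd:
  fixes F :: "3 cpoly"
  assumes "homogeneous_of_degree n F"
  shows "polyd n (\<lambda>s. cpoly_at F (($) (u + s *s v)))"
  unfolding cpoly_at_def
proof (intro polyd_sum polyd_cmult)
  fix m assume "m \<in> Poly_Mapping.keys F"
  then have "(\<Sum>k\<in>Poly_Mapping.keys m. Poly_Mapping.lookup m k * 1) = n"
    using assms by (simp add: homogeneous_of_degree_def)
  moreover have "polyd (\<Sum>k\<in>Poly_Mapping.keys m. Poly_Mapping.lookup m k * 1)
      (\<lambda>s. \<Prod>k\<in>Poly_Mapping.keys m. (u + s *s v) $ k ^ Poly_Mapping.lookup m k)"
    using polyd_affine by (intro polyd_prod polyd_power) simp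
  ultimately show "polyd n (\<lambda>s. \<Prod>k\<in>Poly_Mapping.keys m. (u + s *s v) $ k ^ Poly_Mapping.lookup m k)"
    by simp
qed

text \<open>Zeros on the affine part force vanishing there by degree. The point at infinity follows
  from the polynomial in \<open>t\<close> given by \<open>\<beta> *s v + t *s u\<close>, which
  vanishes for every nonzero \<open>t\<close>.\<close>

lemma form_vanishes_on_line:
  fixes F :: "3 cpoly"
  assumes F: "homogeneous_of_degree n F" and S: "finite S" "card S > n"
    and zero: "\<And>s. s \<in> S \<Longrightarrow> cpoly_at F (($) (u + s *s v)) = 0"
  shows "cpoly_at F (($) (\<alpha> *s u + \<beta> *s v)) = 0"
proof -
  have z: "cpoly_at F (($) (u + s *s v)) = 0" for s
    using polyd_eq_zero[OF cpoly_at_line_polyd[OF F] S zero] .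
  have nz: "cpoly_at F (($) (\<beta> *s v + t *s u)) = 0" if "t \<noteq> 0" for t
  proof -
    have eq: "\<beta> *s v + t *s u = t *s (u + (\<beta> / t) *s v)"
      using that by (simp add: vec_eq_iff algebra_simps)
    show ?thesis unfolding eq homogeneous_at_scale[OF F] z by simp
  qed
  have "finite (of_nat ` {1..Suc n} :: complex set)" "card (of_nat ` {1..Suc n} :: complex set) > n"
    by (auto simp: card_image inj_on_def)
  then have "cpoly_at F (($) (\<beta> *s v + \<alpha> *s u)) = 0"
    by (rule polyd_eq_zero[OF cpoly_at_line_polyd[OF F]]) (use nz in auto)
  then show ?thesis by (simp add: add.commute)
qed

text \<open>Restricted to the \<open>i\<close>-th line, the form is determined up to a scalar \<open>c i\<close> by its zeros; once
  these scalars are adjusted, the difference vanishes on all \<open>n + 1\<close> lines, hence everywhere.\<close>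

theorem vanishing_at_vertices_imp_dform:
  assumes gp: "gen_pos n a" and n: "n \<ge> 2" and F: "homogeneous_of_degree n F"
    and vert: "\<And>i j. i \<le> n \<Longrightarrow> j \<le> n \<Longrightarrow> i \<noteq> j \<Longrightarrow> cpoly_at F (($) (crossc (a i) (a j))) = 0"
  shows "\<exists>c. F = dform n a c"
proof -
  define Q where "Q i q w \<longleftrightarrow> dotc (a i) q = 0 \<and> dotc (a i) w = 0 \<and>
    (\<forall>j\<le>n. j \<noteq> i \<longrightarrow> dotc (a j) q \<noteq> 0 \<and> dotc (a j) w \<noteq> 0) \<and>
    (\<forall>s. q + s *s w \<noteq> 0) \<and> (\<forall>x. dotc (a i) x = 0 \<longrightarrow> (\<exists>\<alpha> \<beta>. x = \<alpha> *s q + \<beta> *s w))" for i q w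
  have "\<exists>z. i \<le> n \<longrightarrow> Q i (fst z) (snd z)" for i
    using points_on_line[OF gp n, of i] unfolding Q_def[symmetric] by auto
  then obtain z where z: "\<And>i. i \<le> n \<Longrightarrow> Q i (fst (z i)) (snd (z i))" by metis
  define q where "q i = fst (z i)" for i
  define w where "w i = snd (z i)" for i
  have qw: "\<And>i. i \<le> n \<Longrightarrow> dotc (a i) (q i) = 0" "\<And>i. i \<le> n \<Longrightarrow> dotc (a i) (w i) = 0"
      "\<And>i j. i \<le> n \<Longrightarrow> j \<le> n \<Longrightarrow> j \<noteq> i \<Longrightarrow> dotc (a j) (q i) \<noteq> 0 \<and> dotc (a j) (w i) \<noteq> 0"
      "\<And>i s. i \<le> n \<Longrightarrow> q i + s *s w i \<noteq> 0"
      "\<And>i x. i \<le> n \<Longrightarrow> dotc (a i) x = 0 \<Longrightarrow> \<exists>\<alpha> \<beta>. x = \<alpha> *s q i + \<beta> *s w i"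
    using z unfolding Q_def q_def w_def by blast+
  \<comment> \<open>The scalar that makes both forms agree at the non-vertex
    \<open>q i\<close>.\<close>
  define c where "c i = cpoly_at F (($) (q i)) / (\<Prod>j\<in>{..n} - {i}. dotc (a j) (q i))" for i
  define H where "H = F - dform n a c"
  have H: "homogeneous_of_degree n H"
    unfolding H_def by (intro homogeneous_diff F homogeneous_dform)
  have Hq: "cpoly_at H (($) (q i)) = 0" if "i \<le> n" for i
  proof -
    have "(\<Prod>j\<in>{..n} - {i}. dotc (a j) (q i)) \<noteq> 0" using qw(3) that by (auto simp: prod_zero_iff)
    then show ?thesis
      using dform_at_line[of i n a "q i" c] qw(1)[OF that] that by (simp add: H_def c_def)
  qed
  have Hv: "cpoly_at H (($) x) = 0"
    if ij: "i \<le> n" "j \<le> n" "i \<noteq> j" and x: "dotc (a i) x = 0" "dotc (a j) x = 0" for i j x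
  proof -
    obtain t where "x = t *s crossc (a i) (a j)"
      using orthogonal_crossc[OF x gen_pos_crossc_nonzero[OF gp n ij]] by blast
    moreover have "cpoly_at H (($) (crossc (a i) (a j))) = 0"
      using vert[OF ij] dform_at_vertex[OF ij, of a "crossc (a i) (a j)" c] by (simp add: H_def)
    ultimately show ?thesis using homogeneous_at_scale[OF H] by simp
  qed
  have Hl: "cpoly_at H (($) x) = 0" if i: "i \<le> n" and x: "dotc (a i) x = 0" for i x
  proof -
    \<comment> \<open>The parameter of the vertex with line \<open>j\<close>. These \<open>n\<close>
      vertices together with \<open>q i\<close>, at parameter 0, are the n + 1 zeros needed in
      degree \<open>n\<close>.\<close>
    define \<sigma> where "\<sigma> j = - dotc (a j) (q i) / dotc (a j) (w i)" for j
    define S where "S = insert 0 (\<sigma> ` ({..n} - {i}))"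
    have on: "dotc (a j) (q i + \<sigma> j *s w i) = 0" if "j \<le> n" "j \<noteq> i" for j
      using qw(3)[OF i that] by (simp add: \<sigma>_def)
    have on_i: "dotc (a i) (q i + s *s w i) = 0" for s using qw(1,2)[OF i] by simp
    have "inj_on \<sigma> ({..n} - {i})"
    proof (rule inj_onI, rule ccontr)
      fix j k assume jk: "j \<in> {..n} - {i}" "k \<in> {..n} - {i}" "\<sigma> j = \<sigma> k" "j \<noteq> k"
      have "q i + \<sigma> j *s w i = 0"
      proof (rule det3_orthogonal)
        show "det3 (a i) (a j) (a k) \<noteq> 0" using jk i by (intro gen_pos_det3[OF gp]) auto
        show "dotc (a j) (q i + \<sigma> j *s w i) = 0" using on jk by blast
        show "dotc (a k) (q i + \<sigma> j *s w i) = 0" unfolding jk(3) using on jk by blast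
      qed (rule on_i)
      then show False using qw(4)[OF i] by blast
    qed
    moreover have "0 \<notin> \<sigma> ` ({..n} - {i})"
    proof
      assume "0 \<in> \<sigma> ` ({..n} - {i})"
      then obtain j where "j \<le> n" "j \<noteq> i" "\<sigma> j = 0" by force
      then show False using qw(3)[OF i, of j] by (auto simp: \<sigma>_def)
    qed
    ultimately have "card S = Suc n" using i by (simp add: S_def card_image)
    moreover have "cpoly_at H (($) (q i + s *s w i)) = 0" if "s \<in> S" for s
      using that Hq[OF i] Hv[of i _ "q i + s *s w i"] on on_i i by (auto simp: S_def)
    ultimately have "cpoly_at H (($) (\<alpha> *s q i + \<beta> *s w i)) = 0" for \<alpha> \<beta>
      by (intro form_vanishes_on_line[OF H, of S]) (auto simp: S_def)
    then show ?thesis using qw(5)[OF i x] by auto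
  qed
  have "cpoly_at H (($) x) = 0" for x
  proof (cases "\<exists>i\<le>n. dotc (a i) x = 0")
    case True
    then show ?thesis using Hl by blast
  next
    case False
    \<comment> \<open>A point \<open>x\<close> off all lines is joined to a \<open>w\<close> whose
      line through \<open>x\<close> meets the n + 1 lines in distinct points; \<open>w\<close> must
      avoid one linear condition per pair.\<close>
    let ?P = "{(i, j). i \<le> n \<and> j \<le> n \<and> i \<noteq> j}"
    have "finite ?P" by (rule finite_subset[of _ "{..n} \<times> {..n}"]) auto
    moreover have "dotc (a (snd p)) x *s a (fst p) - dotc (a (fst p)) x *s a (snd p) \<noteq> 0"
      if "p \<in> ?P" for p
    proof
      assume z: "dotc (a (snd p)) x *s a (fst p) - dotc (a (fst p)) x *s a (snd p) = 0"
      have "dotc (a (snd p)) x *s crossc (a (fst p)) (a (snd p)) =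
        crossc (dotc (a (snd p)) x *s a (fst p) - dotc (a (fst p)) x *s a (snd p)) (a (snd p))"
        by (simp add: vec_eq_iff forall_3 algebra_simps)
      also have "\<dots> = 0" unfolding z by (simp add: vec_eq_iff forall_3)
      finally show False
        using False that gen_pos_crossc_nonzero[OF gp n, of "fst p" "snd p"] by auto
    qed
    ultimately have "\<exists>w. \<forall>p\<in>?P. dotc (dotc (a (snd p)) x *s a (fst p) - dotc (a (fst p)) x *s a (snd p)) w \<noteq> 0"
      by (rule dotc_nonzero_exists)
    then obtain w where w: "\<And>i j. i \<le> n \<Longrightarrow> j \<le> n \<Longrightarrow> i \<noteq> j \<Longrightarrow>
        dotc (a j) x * dotc (a i) w \<noteq> dotc (a i) x * dotc (a j) w"
      by fastforce
    define \<sigma> where "\<sigma> i = - dotc (a i) w / dotc (a i) x" for i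
    have nz: "dotc (a i) x \<noteq> 0" if "i \<le> n" for i using False that by blast
    have "inj_on \<sigma> {..n}"
    proof (rule inj_onI, rule ccontr)
      fix i j assume "i \<in> {..n}" "j \<in> {..n}" "\<sigma> i = \<sigma> j" "i \<noteq> j"
      then show False using w[of i j] nz[of i] nz[of j] by (auto simp: \<sigma>_def field_simps)
    qed
    then have "card (\<sigma> ` {..n}) > n" by (simp add: card_image)
    moreover have "cpoly_at H (($) (w + s *s x)) = 0" if s: "s \<in> \<sigma> ` {..n}" for s
    proof -
      obtain i where i: "i \<le> n" "s = \<sigma> i" using s by auto
      then have "dotc (a i) (w + s *s x) = 0" using nz by (simp add: \<sigma>_def)
      then show ?thesis using Hl i by blast
    qed
    ultimately have "cpoly_at H (($) (0 *s w + 1 *s x)) = 0"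
      by (intro form_vanishes_on_line[OF H]) auto
    then show ?thesis by simp
  qed
  then have "cpoly_at H y = 0" for y :: "3 \<Rightarrow> complex"
    by (metis vec_lambda_inverse UNIV_I)
  then have "H = 0" by (rule ternary_cpoly_eq_zero)
  then show ?thesis unfolding H_def by auto
qed

subsection \<open>The tangent map\<close>

text \<open>The derivative at \<open>a\<close>, in direction \<open>m\<close>, of the form with all
  scalars 1, evaluated at the point \<open>v\<close>.\<close>

definition tform :: "nat \<Rightarrow> (nat \<Rightarrow> complex ^ 3) \<Rightarrow> (nat \<Rightarrow> complex ^ 3) \<Rightarrow> complex ^ 3 \<Rightarrow> complex" where
  "tform n a m v =
     (\<Sum>j\<le>n. dotc (m j) v * (\<Sum>i\<in>{..n} - {j}. \<Prod>k\<in>{..n} - {i} - {j}. dotc (a k) v))"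

text \<open>A product omitting two lines survives at the vertex only if the omitted lines are
  exactly \<open>i\<close> and \<open>j\<close>.\<close>

lemma tform_at_vertex:
  assumes "i \<le> n" "j \<le> n" "i \<noteq> j" "dotc (a i) v = 0" "dotc (a j) v = 0"
  shows "tform n a m v = (dotc (m i) v + dotc (m j) v) * (\<Prod>k\<in>{..n} - {i} - {j}. dotc (a k) v)"
proof -
  define W where "W l = (\<Sum>i\<in>{..n} - {l}. \<Prod>k\<in>{..n} - {i} - {l}. dotc (a k) v)" for l
  define \<pi> where "\<pi> = (\<Prod>k\<in>{..n} - {i} - {j}. dotc (a k) v)"
  have zero: "(\<Prod>k\<in>{..n} - {i'} - {l}. dotc (a k) v) = 0" if "\<not> {i, j} \<subseteq> {i', l}" for i' l
    using that assms by (intro prod_zero) auto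
  have "W l = 0" if "l \<noteq> i" "l \<noteq> j" for l
    unfolding W_def using that assms(3) by (intro sum.neutral ballI zero) auto
  moreover have "W i = \<pi>"
  proof -
    have "W i = (\<Sum>l\<in>{..n} - {i}. if l = j then \<pi> else 0)"
      unfolding W_def
    proof (intro sum.cong refl)
      fix l assume "l \<in> {..n} - {i}"
      then show "(\<Prod>k\<in>{..n} - {l} - {i}. dotc (a k) v) = (if l = j then \<pi> else 0)"
        using zero[of l i] assms(3) by (auto simp: \<pi>_def insert_commute Diff_insert[symmetric])
    qed
    then show ?thesis using assms(2,3) by simp
  qed
  moreover have "W j = \<pi>"
  proof -
    have "W j = (\<Sum>l\<in>{..n} - {j}. if l = i then \<pi> else 0)"
      unfolding W_def
    proof (intro sum.cong refl)
      fix l assume "l \<in> {..n} - {j}"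
      then show "(\<Prod>k\<in>{..n} - {l} - {j}. dotc (a k) v) = (if l = i then \<pi> else 0)"
        using zero[of l j] assms(3) by (auto simp: \<pi>_def)
    qed
    then show ?thesis using assms(1,3) by simp
  qed
  ultimately have "tform n a m v
      = (\<Sum>l\<le>n. (if l = i then dotc (m i) v * \<pi> else 0) + (if l = j then dotc (m j) v * \<pi> else 0))"
    unfolding tform_def W_def[symmetric] using assms(3) by (intro sum.cong refl) auto
  also have "\<dots> = (dotc (m i) v + dotc (m j) v) * \<pi>"
    using assms(1,2) by (simp add: sum.distrib distrib_right)
  finally show ?thesis by (simp add: \<pi>_def)
qed

lemma tform_zero_at_vertices:
  assumes gp: "gen_pos n a" and ij: "i \<le> n" "j \<le> n" "i \<noteq> j" and z: "\<And>v. tform n a m v = 0"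
  shows "dotc (m i) (crossc (a i) (a j)) + dotc (m j) (crossc (a i) (a j)) = 0"
proof -
  let ?p = "crossc (a i) (a j)"
  have "(\<Prod>k\<in>{..n} - {i} - {j}. dotc (a k) ?p) \<noteq> 0"
    using gen_pos_vertex[OF gp] ij by (auto simp: prod_zero_iff)
  then show ?thesis using tform_at_vertex[OF ij, of a ?p m] z[of ?p] by simp
qed

text \<open>Scaling the j-th line rescales exactly the products containing it, that is all but the
  j-th one.\<close>

lemma tform_multiples:
  assumes "\<And>i. i \<le> n \<Longrightarrow> m i = \<alpha> i *s a i"
  shows "tform n a m v = cpoly_at (dform n a (\<lambda>i. \<Sum>j\<in>{..n} - {i}. \<alpha> j)) (($) v)"
proof -
  let ?d = "\<lambda>k. dotc (a k) v"
  have "tform n a m v = (\<Sum>j\<le>n. \<Sum>i\<in>{..n} - {j}. \<alpha> j * prod ?d ({..n} - {i}))"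
    unfolding tform_def sum_distrib_left
  proof (intro sum.cong refl)
    fix j i assume "j \<in> {..n}" "i \<in> {..n} - {j}"
    then show "dotc (m j) v * prod ?d ({..n} - {i} - {j}) = \<alpha> j * prod ?d ({..n} - {i})"
      using assms[of j] prod.remove[of "{..n} - {i}" j ?d] by simp
  qed
  also have "\<dots> = (\<Sum>j\<le>n. \<Sum>i | i \<in> {..n} \<and> i \<noteq> j. \<alpha> j * prod ?d ({..n} - {i}))"
    by (intro sum.cong) auto
  also have "\<dots> = (\<Sum>i\<le>n. \<Sum>j | j \<in> {..n} \<and> i \<noteq> j. \<alpha> j * prod ?d ({..n} - {i}))"
    by (rule sum.swap_restrict) auto
  also have "\<dots> = (\<Sum>i\<le>n. (\<Sum>j\<in>{..n} - {i}. \<alpha> j) * prod ?d ({..n} - {i}))"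
    unfolding sum_distrib_right by (intro sum.cong) auto
  finally show ?thesis by (simp add: cpoly_at_dform)
qed

text \<open>At a non-vertex of line \<open>i\<close> only the i-th scalar is seen, so all scalars
  vanish. Hence every \<open>\<alpha> i\<close> equals the total sum, which is then n + 1 times
  itself, hence 0.\<close>

lemma tform_multiples_eq_zero:
  assumes gp: "gen_pos n a" and n: "n \<ge> 2" and m: "\<And>i. i \<le> n \<Longrightarrow> m i = \<alpha> i *s a i"
    and z: "\<And>v. tform n a m v = 0" and i: "i \<le> n"
  shows "m i = 0"
proof -
  have eq: "tform n a m v = cpoly_at (dform n a (\<lambda>i. \<Sum>j\<in>{..n} - {i}. \<alpha> j)) (($) v)" for v
    by (rule tform_multiples) (rule m)
  have c: "(\<Sum>j\<in>{..n} - {i}. \<alpha> j) = 0" if i: "i \<le> n" for i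
  proof -
    obtain q where q: "dotc (a i) q = 0" "\<And>j. j \<le> n \<Longrightarrow> j \<noteq> i \<Longrightarrow> dotc (a j) q \<noteq> 0"
      using points_on_line[OF gp n i] by blast
    have "(\<Prod>j\<in>{..n} - {i}. dotc (a j) q) \<noteq> 0" using q(2) by (auto simp: prod_zero_iff)
    then show ?thesis
      using z[of q] dform_at_line[of i n a q, OF i q(1)] unfolding eq by simp
  qed
  have \<alpha>: "\<alpha> i = (\<Sum>j\<le>n. \<alpha> j)" if "i \<le> n" for i
  proof -
    have "(\<Sum>j\<le>n. \<alpha> j) = \<alpha> i + (\<Sum>j\<in>{..n} - {i}. \<alpha> j)"
      using that by (intro sum.remove) auto
    then show ?thesis unfolding c[OF that] by simp
  qed
  have "(\<Sum>j\<le>n. \<alpha> j) = (\<Sum>i\<le>n. (\<Sum>j\<le>n. \<alpha> j))" by (intro sum.cong refl \<alpha>) auto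
  then have "of_nat n * (\<Sum>j\<le>n. \<alpha> j) = 0" by (simp add: distrib_right)
  then have "\<alpha> i = 0" using \<alpha>[OF i] n by simp
  then show ?thesis using m[OF i] by simp
qed

text \<open>Lines tangent to a conic would not do here: by Darboux's theorem they move in a family
  inscribed in the same curve. Hence the dual cubic \<open>(1, t, t\<^sup>3)\<close>.\<close>

definition cubic_line :: "nat \<Rightarrow> complex ^ 3" where
  "cubic_line i = vector [1, of_nat (i + 1), of_nat (i + 1) ^ 3]"

lemma cubic_line_nth [simp]:
  "cubic_line i $ 1 = 1" "cubic_line i $ 2 = of_nat (i + 1)" "cubic_line i $ 3 = of_nat (i + 1) ^ 3"
  by (simp_all add: cubic_line_def)

text \<open>The generalized Vandermonde determinant with exponents 0, 1, 3 is the usual one times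
  the sum of the nodes, and the nodes are positive.\<close>

lemma gen_pos_cubic_line: "gen_pos n cubic_line"
  unfolding gen_pos_def
proof (intro allI impI, elim conjE)
  fix i j k :: nat
  assume d: "i \<noteq> j" "j \<noteq> k" "i \<noteq> k"
  let ?x = "of_nat (i + 1) :: complex" and ?y = "of_nat (j + 1) :: complex"
    and ?z = "of_nat (k + 1) :: complex"
  have "det3 (cubic_line i) (cubic_line j) (cubic_line k)
      = (?y - ?x) * (?z - ?x) * (?z - ?y) * (?x + ?y + ?z)"
    unfolding det3_def dotc_3 crossc_nth cubic_line_nth by algebra
  moreover have "?x + ?y + ?z \<noteq> 0"
    unfolding of_nat_add[symmetric] of_nat_eq_0_iff by simp
  moreover have "?y - ?x \<noteq> 0" "?z - ?x \<noteq> 0" "?z - ?y \<noteq> 0" using d by auto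
  ultimately show "det3 (cubic_line i) (cubic_line j) (cubic_line k) \<noteq> 0" by simp
qed

text \<open>Fifteen equations of full rank in twelve unknowns. No five lines could serve the case n
  = 4 in this way, since Lueroth quartics carry infinitely many inscribed pentagons.\<close>

lemma six_lines_system:
  fixes v w :: "nat \<Rightarrow> complex"
  assumes "\<And>i j. i < j \<Longrightarrow> j \<le> 5 \<Longrightarrow> w i + w j =
    (of_nat (i + 1) ^ 2 + of_nat (i + 1) * of_nat (j + 1) + of_nat (j + 1) ^ 2) * (v i + v j)"
    and "i \<le> 5"
  shows "v i = 0 \<and> w i = 0"
proof -
  define r where "r i j k = w i + w j - k * (v i + v j)" for i j k
  have r: "r i j k = 0"
    if "i < j" "j \<le> 5" "of_nat (i + 1) ^ 2 + of_nat (i + 1) * of_nat (j + 1) + of_nat (j + 1) ^ 2 = k"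
    for i j k
    using assms(1)[OF that(1,2)] that(3) by (simp add: r_def)
  have r0:
    "r 0 1 7 = 0" "r 0 2 13 = 0" "r 0 3 21 = 0" "r 0 4 31 = 0" "r 0 5 43 = 0"
    "r 1 2 19 = 0" "r 1 3 28 = 0" "r 1 4 39 = 0" "r 1 5 52 = 0" "r 2 3 37 = 0"
    "r 2 4 49 = 0" "r 2 5 63 = 0" "r 3 4 61 = 0" "r 3 5 76 = 0" "r 4 5 91 = 0"
    by (rule r; simp add: power2_eq_square)+
  \<comment> \<open>An elimination certificate: a multiple of the unknown as an integer combination
    of the residuals \<open>r\<close>. The five that follow are of the same kind.\<close>
  have "84 * v 0 = - 88 * r 0 1 7 + 108 * r 0 2 13 + 1 * r 0 4 31 - 21 * r 0 5 43
      + 256 * r 1 3 28 - 168 * r 1 4 39 - 317 * r 2 3 37 + 203 * r 2 4 49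
      + 6 * r 2 5 63 + 5 * r 3 4 61 + 56 * r 3 5 76 - 41 * r 4 5 91"
    unfolding r_def by algebra
  then have v0: "v 0 = 0" unfolding r0 by simp
  have "84 * v 1 = - 217 * r 0 2 13 + 93 * r 0 3 21 + 372 * r 0 4 31 - 248 * r 0 5 43
      + 294 * r 1 2 19 - 170 * r 1 3 28 - 426 * r 1 4 39 + 302 * r 1 5 52
      - 149 * r 2 4 49 + 72 * r 2 5 63 + 203 * r 3 4 61 - 126 * r 3 5 76"
    unfolding r_def by algebra
  then have v1: "v 1 = 0" unfolding r0 by simp
  have "336 * v 2 = - 213 * r 0 1 7 + 12 * r 0 2 13 + 330 * r 0 3 21 + 4 * r 0 4 31
      - 133 * r 0 5 43 + 332 * r 1 2 19 + 16 * r 1 3 28 - 135 * r 1 4 39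
      - 572 * r 2 3 37 + 228 * r 2 5 63 + 226 * r 3 4 61 - 95 * r 4 5 91"
    unfolding r_def by algebra
  then have v2: "v 2 = 0" unfolding r0 by simp
  have "252 * v 3 = - 151 * r 0 1 7 + 354 * r 0 3 21 - 196 * r 0 4 31 - 7 * r 0 5 43
      + 204 * r 1 2 19 + 14 * r 1 3 28 - 21 * r 1 4 39 - 46 * r 1 5 52
      - 510 * r 2 3 37 + 306 * r 2 4 49 + 142 * r 3 5 76 - 89 * r 4 5 91"
    unfolding r_def by algebra
  then have v3: "v 3 = 0" unfolding r0 by simp
  have "84 * v 4 = - 63 * r 0 1 7 + 89 * r 0 2 13 - 9 * r 0 3 21 - 17 * r 0 4 31
      - 6 * r 1 2 19 + 128 * r 1 3 28 - 3 * r 1 4 39 - 56 * r 1 5 52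
      - 161 * r 2 3 37 + 78 * r 2 5 63 + 42 * r 3 4 61 - 22 * r 4 5 91"
    unfolding r_def by algebra
  then have v4: "v 4 = 0" unfolding r0 by simp
  have "42 * v 5 = - 77 * r 0 2 13 + 27 * r 0 3 21 + 143 * r 0 4 31 - 93 * r 0 5 43
      + 105 * r 1 2 19 - 55 * r 1 3 28 - 165 * r 1 4 39 + 115 * r 1 5 52
      - 55 * r 2 4 49 + 27 * r 2 5 63 + 77 * r 3 4 61 - 49 * r 3 5 76"
    unfolding r_def by algebra
  then have v5: "v 5 = 0" unfolding r0 by simp
  note v = v0 v1 v2 v3 v4 v5
  have "2 * w 0 = r 0 1 7 + r 0 2 13 - r 1 2 19" unfolding r_def v by simp
  then have w0: "w 0 = 0" unfolding r0 by simp
  have "w 1 = r 0 1 7" "w 2 = r 0 2 13" "w 3 = r 0 3 21" "w 4 = r 0 4 31" "w 5 = r 0 5 43"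
    unfolding r_def v w0 by simp_all
  then have w: "w 1 = 0" "w 2 = 0" "w 3 = 0" "w 4 = 0" "w 5 = 0" unfolding r0 by simp_all
  have "i \<in> {0, 1, 2, 3, 4, 5}" using assms(2) by auto
  then show ?thesis using v w0 w by auto
qed

text \<open>With nodes x and y, the vertex is y - x times (xy(x + y), -(x^2 + xy + y^2), 1). Once
  the first coordinates are removed, this yields the system above.\<close>

lemma six_lines:
  assumes z: "\<And>i j. i \<le> 5 \<Longrightarrow> j \<le> 5 \<Longrightarrow> i \<noteq> j \<Longrightarrow>
      dotc (m i) (crossc (cubic_line i) (cubic_line j)) + dotc (m j) (crossc (cubic_line i) (cubic_line j)) = 0"
    and i: "i \<le> 5"
  shows "m i = (m i $ 1) *s cubic_line i"
proof -
  \<comment> \<open>Line \<open>i\<close> vanishes at its own vertices, so subtracting a multiple of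
    it keeps the vertex equations.\<close>
  define \<mu> where "\<mu> i = m i - (m i $ 1) *s cubic_line i" for i
  define v where "v i = \<mu> i $ 2" for i
  define w where "w i = \<mu> i $ 3" for i
  define c where "c i = (of_nat (i + 1) :: complex)" for i
  have vw: "w i + w j = ((c i)\<^sup>2 + c i * c j + (c j)\<^sup>2) * (v i + v j)"
    if ij: "i < j" "j \<le> 5" for i j
  proof -
    have "dotc (\<mu> i) (crossc (cubic_line i) (cubic_line j)) + dotc (\<mu> j) (crossc (cubic_line i) (cubic_line j)) = 0"
      using z[of i j] ij by (simp add: \<mu>_def del: crossc_nth)
    moreover have "\<mu> i $ 1 = 0" "\<mu> j $ 1 = 0" by (simp_all add: \<mu>_def)
    ultimately have "(c j - c i) * (w i + w j - ((c i)\<^sup>2 + c i * c j + (c j)\<^sup>2) * (v i + v j)) = 0"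
      unfolding dotc_3 crossc_nth cubic_line_nth c_def[symmetric] v_def[symmetric] w_def[symmetric]
      by algebra
    moreover have "c j - c i \<noteq> 0" using ij by (simp add: c_def)
    ultimately show ?thesis by simp
  qed
  then have "v i = 0" "w i = 0"
    using six_lines_system[of w v i, OF _ i] unfolding c_def by blast+
  moreover have "\<mu> i $ 1 = 0" by (simp add: \<mu>_def)
  ultimately have "\<mu> i = 0" by (simp add: vec_eq_iff forall_3 v_def w_def)
  then show ?thesis by (simp add: \<mu>_def)
qed

lemma tform_cubic_inj:
  assumes n: "n \<ge> 5" and z: "\<And>v. tform n cubic_line m v = 0" and i: "i \<le> n"
  shows "m i = 0"
proof -
  let ?a = cubic_line
  note gp = gen_pos_cubic_line[of n]
  have vert: "dotc (m i) (crossc (?a i) (?a j)) + dotc (m j) (crossc (?a i) (?a j)) = 0"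
    if "i \<le> n" "j \<le> n" "i \<noteq> j" for i j
    using tform_zero_at_vertices[OF gp that z] .
  have small: "m i = (m i $ 1) *s ?a i" if "i \<le> 5" for i
    using n that by (intro six_lines vert) auto
  have "\<exists>\<alpha>. m i = \<alpha> *s ?a i" if i: "i \<le> n" for i
  proof (cases "i \<le> 5")
    case True
    then show ?thesis using small by blast
  next
    case False
    have "dotc (m i) (crossc (?a i) (?a j)) = 0" if "j \<le> 5" for j
    proof -
      have "dotc (m j) (crossc (?a i) (?a j)) = 0" by (subst small[OF that]) simp
      then show ?thesis using vert[of i j] i that n False by simp
    qed
    then have "dotc (m i) (crossc (?a i) (?a 0)) = 0" "dotc (m i) (crossc (?a i) (?a 1)) = 0" by auto
    then have "dotc (crossc (?a i) (?a 0)) (m i) = 0" "dotc (crossc (?a i) (?a 1)) (m i) = 0"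
      by (simp_all add: dotc_3 mult.commute)
    \<comment> \<open>The line through two vertices of line \<open>i\<close> is line
      \<open>i\<close> again.\<close>
    moreover have cr: "crossc (crossc (?a i) (?a 0)) (crossc (?a i) (?a 1)) = det3 (?a i) (?a 0) (?a 1) *s ?a i"
      by (simp only: vec_eq_iff forall_3 det3_def dotc_3 crossc_nth vector_smult_component) algebra
    moreover have "det3 (?a i) (?a 0) (?a 1) \<noteq> 0"
      using False n i by (intro gen_pos_det3[OF gp]) auto
    moreover have "?a i \<noteq> 0" using n i by (intro gen_pos_nonzero[OF gp]) auto
    ultimately have "\<exists>t. m i = t *s (det3 (?a i) (?a 0) (?a 1) *s ?a i)"
      using orthogonal_crossc[of "crossc (?a i) (?a 0)" "m i" "crossc (?a i) (?a 1)"]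
      unfolding cr by (auto simp: vector_mul_eq_0)
    then show ?thesis by (metis vector_smult_assoc)
  qed
  then obtain \<alpha> where "\<And>i. i \<le> n \<Longrightarrow> m i = \<alpha> i *s ?a i" by metis
  then show ?thesis
    using n by (intro tform_multiples_eq_zero[where \<alpha> = \<alpha>, OF gp _ _ z i]) auto
qed

subsection \<open>Dominance\<close>

text \<open>With its inverse \<open>coord\<close>, this lets slot \<open>3 * j + idx k\<close> hold
  coordinate \<open>k\<close> of line \<open>j\<close>.\<close>

definition idx :: "3 \<Rightarrow> nat" where
  "idx k = (if k = 1 then 0 else if k = 2 then 1 else 2)"

definition coord :: "nat \<Rightarrow> 3" where
  "coord r = (if r = 0 then 1 else if r = 1 then 2 else 3)"

lemma idx_less [simp]: "idx k < 3"
  by (simp add: idx_def)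

lemma coord_idx [simp]: "coord (idx k) = k"
  using exhaust_3[of k] by (auto simp: coord_def idx_def)

lemma idx_coord: "r < 3 \<Longrightarrow> idx (coord r) = r"
  by (auto simp: coord_def idx_def)

lemma idx_div_mod [simp]: "(3 * j + idx k) div 3 = j" "(3 * j + idx k) mod 3 = idx k"
  using idx_less[of k] by simp_all

lemma idx_bound: "j \<le> n \<Longrightarrow> 3 * j + idx k < 3 * (n + 1)"
  using idx_less[of k] by presburger

definition vecs :: "(nat \<Rightarrow> complex) \<Rightarrow> nat \<Rightarrow> complex ^ 3" where
  "vecs x j = (\<chi> k. x (3 * j + idx k))"

lemma vecs_nth [simp]: "vecs x j $ k = x (3 * j + idx k)"
  by (simp add: vecs_def)

lemma tform_vecs:
  "tform n a (vecs x) v = (\<Sum>q<3 * (n + 1). x q * tform n a (vecs (\<lambda>r. if r = q then 1 else 0)) v)"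
proof -
  let ?e = "\<lambda>q r. if r = q then 1 else (0 :: complex)"
  have d: "dotc (vecs x j) v = (\<Sum>q<3 * (n + 1). x q * dotc (vecs (?e q) j) v)" if "j \<le> n" for j
  proof -
    have "x (3 * j + idx k) = (\<Sum>q<3 * (n + 1). x q * ?e q (3 * j + idx k))" for k
      using idx_bound[OF that, of k] by (simp add: if_distrib cong: if_cong)
    then have "(\<Sum>k\<in>UNIV. x (3 * j + idx k) * v $ k)
        = (\<Sum>k\<in>UNIV. \<Sum>q<3 * (n + 1). x q * (?e q (3 * j + idx k) * v $ k))"
      by (simp add: sum_distrib_right mult.assoc)
    also have "\<dots> = (\<Sum>q<3 * (n + 1). x q * (\<Sum>k\<in>UNIV. ?e q (3 * j + idx k) * v $ k))"
      unfolding sum_distrib_left by (rule sum.swap)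
    finally show ?thesis by (simp add: dotc_def)
  qed
  have "tform n a (vecs x) v = (\<Sum>j\<le>n. \<Sum>q<3 * (n + 1). x q * (dotc (vecs (?e q) j) v *
      (\<Sum>i\<in>{..n} - {j}. \<Prod>k\<in>{..n} - {i} - {j}. dotc (a k) v)))"
    unfolding tform_def by (intro sum.cong refl) (simp add: d sum_distrib_right mult.assoc)
  also have "\<dots> = (\<Sum>q<3 * (n + 1). x q * tform n a (vecs (?e q)) v)"
    unfolding tform_def sum_distrib_left[of "x _"] by (rule sum.swap)
  finally show ?thesis .
qed

text \<open>Injectivity of the differential in coordinates, in the shape required by
  \<open>dual_functionals\<close>.\<close>

lemma tform_cubic_independent:
  assumes "n \<ge> 5"
    and "\<And>v. (\<Sum>q<3 * (n + 1). x q * tform n cubic_line (vecs (\<lambda>r. if r = q then 1 else 0)) v) = 0"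
  shows "\<forall>q<3 * (n + 1). x q = 0"
proof (intro allI impI)
  fix q assume q: "q < 3 * (n + 1)"
  have "tform n cubic_line (vecs x) v = 0" for v unfolding tform_vecs[of n _ x] by (rule assms(2))
  moreover have "q div 3 \<le> n" using q by simp
  ultimately have "vecs x (q div 3) = 0" using tform_cubic_inj[OF assms(1)] by blast
  then have "vecs x (q div 3) $ coord (q mod 3) = 0" by simp
  then show "x q = 0" by (simp add: idx_coord)
qed

lemma coeff_prod_linear:
  fixes x y :: "'i \<Rightarrow> complex"
  assumes "finite J"
  shows "coeff (\<Prod>j\<in>J. [:x j, y j:]) 0 = prod x J"
    and "coeff (\<Prod>j\<in>J. [:x j, y j:]) 1 = (\<Sum>j\<in>J. y j * prod x (J - {j}))"
    and "degree (\<Prod>j\<in>J. [:x j, y j:]) \<le> card J"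
  using assms
proof (induction J rule: finite_induct)
  case (insert i J)
  let ?P = "\<Prod>j\<in>J. [:x j, y j:]"
  { case 1 show ?case using insert by (simp add: coeff_mult) }
  { case 2
    have "(\<Sum>j\<in>J. y j * prod x (insert i J - {j})) = x i * (\<Sum>j\<in>J. y j * prod x (J - {j}))"
      unfolding sum_distrib_left
    proof (intro sum.cong refl)
      fix j assume j: "j \<in> J"
      then have "insert i J - {j} = insert i (J - {j})" using insert.hyps by auto
      then show "y j * prod x (insert i J - {j}) = x i * (y j * prod x (J - {j}))"
        using insert.hyps by simp
    qed
    moreover have "coeff ([:x i, y i:] * ?P) 1 = x i * coeff ?P 1 + y i * coeff ?P 0" by simp
    ultimately show ?case using insert by simp }
  { case 3
    have "degree ([:x i, y i:] * ?P) \<le> 1 + card J"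
      using insert.IH(3) by (intro order_trans[OF degree_mult_le] add_mono) auto
    then show ?case using insert.hyps by simp }
qed simp_all

text \<open>Taylor expansion in \<open>s\<close>. The coefficient functions do not depend on
  \<open>s\<close>, so functionals can be applied term by term.\<close>

lemma dform_on_line:
  "\<exists>h. (\<forall>s v. cpoly_at (dform n (\<lambda>j. a j + s *s m j) (\<lambda>_. 1)) (($) v) = (\<Sum>k\<le>n. s ^ k * h k v)) \<and>
    (\<forall>v. h 0 v = cpoly_at (dform n a (\<lambda>_. 1)) (($) v)) \<and> h 1 = tform n a m"
proof -
  define p where "p v = (\<Sum>i\<le>n. \<Prod>j\<in>{..n} - {i}. [:dotc (a j) v, dotc (m j) v:])" for v
  have "degree (p v) \<le> n" for v
    unfolding p_def
  proof (intro degree_sum_le)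
    fix i assume "i \<in> {..n}"
    then show "degree (\<Prod>j\<in>{..n} - {i}. [:dotc (a j) v, dotc (m j) v:]) \<le> n"
      using coeff_prod_linear(3)[of "{..n} - {i}" "\<lambda>j. dotc (a j) v" "\<lambda>j. dotc (m j) v"] by simp
  qed simp
  then have "poly (p v) s = (\<Sum>k\<le>n. s ^ k * coeff (p v) k)" for s v
    unfolding poly_altdef mult.commute[of "coeff _ _"]
    by (intro sum.mono_neutral_left) (auto simp: coeff_eq_0)
  moreover have "cpoly_at (dform n (\<lambda>j. a j + s *s m j) (\<lambda>_. 1)) (($) v) = poly (p v) s" for s v
    by (simp add: cpoly_at_dform p_def poly_sum poly_prod)
  moreover have "coeff (p v) 0 = cpoly_at (dform n a (\<lambda>_. 1)) (($) v)" for v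
    by (simp add: p_def coeff_sum coeff_prod_linear(1) cpoly_at_dform)
  moreover have "coeff (p v) 1 = tform n a m v" for v
  proof -
    have "coeff (p v) 1 = (\<Sum>i\<le>n. \<Sum>j | j \<in> {..n} \<and> j \<noteq> i.
        dotc (m j) v * (\<Prod>k\<in>{..n} - {i} - {j}. dotc (a k) v))"
      unfolding p_def coeff_sum coeff_prod_linear(2)[OF finite_Diff[OF finite_atMost]]
      by (intro sum.cong) auto
    also have "\<dots> = (\<Sum>j\<le>n. \<Sum>i | i \<in> {..n} \<and> j \<noteq> i.
        dotc (m j) v * (\<Prod>k\<in>{..n} - {i} - {j}. dotc (a k) v))"
      by (rule sum.swap_restrict) auto
    also have "\<dots> = tform n a m v"
      unfolding tform_def sum_distrib_left by (intro sum.cong) auto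
    finally show ?thesis .
  qed
  ultimately show ?thesis by (intro exI[of _ "\<lambda>k v. coeff (p v) k"]) auto
qed

text \<open>Turns general position into the nonvanishing of one polynomial, to be combined with
  others along a line.\<close>

definition gp_prod :: "nat \<Rightarrow> (nat \<Rightarrow> complex ^ 3) \<Rightarrow> complex" where
  "gp_prod n a = (\<Prod>(i, j, k)\<in>{(i, j, k). i \<le> n \<and> j \<le> n \<and> k \<le> n \<and> i \<noteq> j \<and> j \<noteq> k \<and> i \<noteq> k}.
     det3 (a i) (a j) (a k))"

lemma gen_pos_iff: "gen_pos n a \<longleftrightarrow> gp_prod n a \<noteq> 0"
proof -
  have "finite {(i, j, k). i \<le> n \<and> j \<le> n \<and> k \<le> n \<and> i \<noteq> j \<and> j \<noteq> k \<and> i \<noteq> k}"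
    by (rule finite_subset[of _ "{..n} \<times> {..n} \<times> {..n}"]) auto
  then show ?thesis by (auto simp: gen_pos_def gp_prod_def prod_zero_iff)
qed

lemma polyc_gp_prod: "polyc (\<lambda>s. gp_prod n (\<lambda>j. a j + s *s m j))"
  unfolding gp_prod_def case_prod_beta det3_def dotc_3 crossc_nth vector_add_component
    vector_smult_component
  by (intro polyc_prod polyc_add polyc_diff polyc_mult polyc_const polyc_ident)

text \<open>To first order at the polygon \<open>cubic_line\<close>, the functionals \<open>L\<close> of the curve are the coordinates
  of the displacement. So the lowest homogeneous part of \<open>P\<close> at that point, evaluated on a suitable
  displacement, is the leading coefficient of \<open>P\<close> along a line of polygons.\<close>

theorem dform_dominant:
  assumes n: "n \<ge> 5"
  shows "\<exists>L. (\<forall>j. eval_comb (L j)) \<and>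
    (\<forall>P. polyfun P \<longrightarrow> (\<forall>Y Y'. (\<forall>j<3 * (n + 1). Y j = Y' j) \<longrightarrow> P Y = P Y') \<longrightarrow> (\<exists>Y. P Y \<noteq> 0) \<longrightarrow>
      (\<exists>a. gen_pos n a \<and> P (\<lambda>j. L j (\<lambda>v. cpoly_at (dform n a (\<lambda>_. 1)) (($) v))) \<noteq> 0))"
proof -
  define K where "K = 3 * (n + 1)"
  let ?f = "\<lambda>q. tform n cubic_line (vecs (\<lambda>r. if r = q then 1 else 0))"
  obtain L where L: "\<And>j. eval_comb (L j)"
    and dual: "\<And>i j. i < K \<Longrightarrow> j < K \<Longrightarrow> L j (?f i) = (if i = j then 1 else 0)"
    using dual_functionals[where K = K and f = ?f, OF tform_cubic_independent[OF n, folded K_def]] by blast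
  have "\<exists>a. gen_pos n a \<and> P (\<lambda>j. L j (\<lambda>v. cpoly_at (dform n a (\<lambda>_. 1)) (($) v))) \<noteq> 0"
    if P: "polyfun P" and dep: "\<And>Y Y'. (\<forall>j<K. Y j = Y' j) \<Longrightarrow> P Y = P Y'" and Y: "P Y \<noteq> 0" for P Y
  proof -
    define y0 where "y0 j = L j (\<lambda>v. cpoly_at (dform n cubic_line (\<lambda>_. 1)) (($) v))" for j
    have "polyfun (\<lambda>z. P (\<lambda>j. y0 j + z j))"
      using P by (rule polyfun_compose) (intro polyfun.intros)
    then obtain N G where PG: "\<And>z. P (\<lambda>j. y0 j + z j) = (\<Sum>r\<le>N. cpoly_at (G r) z)"
      and G: "\<And>r. homogeneous_of_degree r (G r)"
      using polyfun_homogeneous_parts by blast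
    have "(\<Sum>r\<le>N. cpoly_at (G r) (\<lambda>j. Y j - y0 j)) \<noteq> 0" unfolding PG[symmetric] using Y by simp
    then have ex: "\<exists>r. r \<le> N \<and> (\<exists>z. cpoly_at (G r) z \<noteq> 0)" by (metis (mono_tags, lifting) atMost_iff sum.neutral)
    define r0 where "r0 = (LEAST r. r \<le> N \<and> (\<exists>z. cpoly_at (G r) z \<noteq> 0))"
    obtain z0 where r0: "r0 \<le> N" and z0: "cpoly_at (G r0) z0 \<noteq> 0"
      using LeastI_ex[OF ex] unfolding r0_def by blast
    have low: "cpoly_at (G r) z = 0" if "r < r0" for r z
      using not_less_Least[of r "\<lambda>r. r \<le> N \<and> (\<exists>z. cpoly_at (G r) z \<noteq> 0)"] that r0
      unfolding r0_def[symmetric] by force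
    define a where "a s j = cubic_line j + s *s vecs z0 j" for s j
    obtain h where h: "\<And>s v. cpoly_at (dform n (a s) (\<lambda>_. 1)) (($) v) = (\<Sum>k\<le>n. s ^ k * h k v)"
      and h0: "\<And>v. h 0 v = cpoly_at (dform n cubic_line (\<lambda>_. 1)) (($) v)"
      and h1: "h 1 = tform n cubic_line (vecs z0)"
      using dform_on_line[of n cubic_line "vecs z0"] unfolding a_def by blast
    \<comment> \<open>Defined so that the functionals at \<open>a s\<close> equal
      \<open>y0 j + s * z s j\<close>. From \<open>K\<close> on it is constantly
      \<open>z0 j\<close>, so that \<open>z 0 = z0\<close> holds in every coordinate.\<close>
    define z where "z s j = (if j < K then z0 j + s * (\<Sum>k\<in>{2..n}. s ^ (k - 2) * L j (h k)) else z0 j)" for s j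
    have Lh: "L j (\<lambda>v. cpoly_at (dform n (a s) (\<lambda>_. 1)) (($) v)) = y0 j + s * z s j" if j: "j < K" for s j
    proof -
      have "L j (h 1) = (\<Sum>q<K. z0 q * L j (?f q))"
        unfolding h1 tform_vecs[of n cubic_line z0, abs_def, folded K_def] by (rule eval_comb_linear[OF L])
      also have "\<dots> = (\<Sum>q<K. if q = j then z0 q else 0)"
        using j dual by (intro sum.cong refl) auto
      finally have L1: "L j (h 1) = z0 j" using j by simp
      have L0: "L j (h 0) = y0 j" unfolding y0_def h0[symmetric] by simp
      have split: "{..n} = insert 0 (insert 1 {2..n})" using n by auto
      have "L j (\<lambda>v. cpoly_at (dform n (a s) (\<lambda>_. 1)) (($) v)) = (\<Sum>k\<le>n. s ^ k * L j (h k))"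
        unfolding h by (rule eval_comb_linear[OF L])
      also have "\<dots> = y0 j + s * z0 j + (\<Sum>k\<in>{2..n}. s ^ k * L j (h k))"
        unfolding split using L0 L1 by simp
      also have "(\<Sum>k\<in>{2..n}. s ^ k * L j (h k)) = s * (s * (\<Sum>k\<in>{2..n}. s ^ (k - 2) * L j (h k)))"
        unfolding sum_distrib_left
      proof (intro sum.cong refl)
        fix k assume "k \<in> {2..n}"
        then have "k \<ge> 2" by simp
        then have "Suc (Suc (k - 2)) = k" by simp
        then have "s ^ k = s * (s * s ^ (k - 2))" by (metis power_Suc)
        then show "s ^ k * L j (h k) = s * (s * (s ^ (k - 2) * L j (h k)))" by simp
      qed
      finally show ?thesis using j by (simp add: z_def algebra_simps)
    qed
    \<comment> \<open>The parts of degree below \<open>r0\<close> vanish, so \<open>s ^ r0\<close>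
      factors out and \<open>W 0\<close> is the lowest part at \<open>z0\<close>. A nonzero
      \<open>s\<close> close to the model is then sought, not the model itself.\<close>
    define W where "W s = (\<Sum>r\<in>{r0..N}. s ^ (r - r0) * cpoly_at (G r) (z s))" for s
    have PW: "P (\<lambda>j. L j (\<lambda>v. cpoly_at (dform n (a s) (\<lambda>_. 1)) (($) v))) = s ^ r0 * W s" for s
    proof -
      have "P (\<lambda>j. L j (\<lambda>v. cpoly_at (dform n (a s) (\<lambda>_. 1)) (($) v))) = P (\<lambda>j. y0 j + s * z s j)"
        using Lh by (intro dep) auto
      also have "\<dots> = (\<Sum>r\<le>N. s ^ r * cpoly_at (G r) (z s))"
        unfolding PG cpoly_at_scale[OF G] by simp
      also have "\<dots> = (\<Sum>r\<in>{r0..N}. s ^ r * cpoly_at (G r) (z s))"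
        by (rule sum.mono_neutral_right) (auto simp: low)
      also have "\<dots> = s ^ r0 * W s"
        unfolding W_def sum_distrib_left
        by (intro sum.cong refl) (simp add: power_add[symmetric] mult.assoc[symmetric])
      finally show ?thesis .
    qed
    have polyc_z: "polyc (\<lambda>s. z s j)" for j
      by (cases "j < K") (auto simp: z_def intro!: polyc_add polyc_mult polyc_sum polyc_power polyc_const polyc_ident)
    have "polyc W"
      unfolding W_def
      by (intro polyc_sum polyc_mult polyc_power polyc_ident polyfun_polyc[OF polyfun_cpoly_at] polyc_z)
    moreover have "W 0 \<noteq> 0"
    proof -
      have "z 0 = z0" by (simp add: z_def fun_eq_iff)
      then have "W 0 = (\<Sum>r\<in>{r0..N}. if r = r0 then cpoly_at (G r0) z0 else 0)"
        unfolding W_def by (intro sum.cong refl) auto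
      then show ?thesis using r0 z0 by simp
    qed
    moreover have "polyc (\<lambda>s. gp_prod n (a s))" unfolding a_def by (rule polyc_gp_prod)
    moreover have "gp_prod n (a 0) \<noteq> 0"
      using gen_pos_cubic_line[of n] unfolding gen_pos_iff a_def by simp
    ultimately have "\<exists>s. s \<notin> {0} \<and> (\<forall>g\<in>{W, \<lambda>s. gp_prod n (a s)}. g s \<noteq> 0)"
      by (intro polyc_common_nonzero) auto
    then obtain s where "s \<noteq> 0" "W s \<noteq> 0" "gp_prod n (a s) \<noteq> 0" by auto
    then show ?thesis using PW[of s] by (intro exI[of _ "a s"]) (simp add: gen_pos_iff)
  qed
  then show ?thesis using L unfolding K_def[symmetric] by (intro exI[of _ L]) blast
qed

subsection \<open>Complete polygons\<close>

lemma proj_point_eq_iff: "proj_point u = proj_point v \<longleftrightarrow> (\<exists>c. c \<noteq> 0 \<and> u = c *s v)"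
proof
  assume "proj_point u = proj_point v"
  moreover have "u \<in> proj_point u" unfolding proj_point_def by (rule CollectI, rule exI[of _ 1]) simp
  ultimately show "\<exists>c. c \<noteq> 0 \<and> u = c *s v" unfolding proj_point_def by blast
next
  assume "\<exists>c. c \<noteq> 0 \<and> u = c *s v"
  then obtain c where c: "c \<noteq> 0" "u = c *s v" by blast
  have "d *s u \<in> proj_point v" if "d \<noteq> 0" for d
    unfolding proj_point_def using c that
    by (intro CollectI exI[of _ "d * c"]) (simp add: vector_smult_assoc)
  moreover have "d *s v \<in> proj_point u" if "d \<noteq> 0" for d
    unfolding proj_point_def using c that
    by (intro CollectI exI[of _ "d / c"]) (simp add: vector_smult_assoc)
  ultimately show "proj_point u = proj_point v"
    by (auto simp: proj_point_def[of u] proj_point_def[of v])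
qed

lemma mem_proj_line_iff: "v \<noteq> 0 \<Longrightarrow> proj_point v \<in> proj_line a \<longleftrightarrow> dotc a v = 0"
  unfolding proj_line_def dotc_def[symmetric]
  by (simp add: proj_point_eq_iff) (metis dotc_scale mult_zero_right one_neq_zero vector_smult_lid)

lemma proj_line_memE:
  assumes "p \<in> proj_line a" obtains v where "v \<noteq> 0" "p = proj_point v" "dotc a v = 0"
  using assms unfolding proj_line_def dotc_def[symmetric] by blast

lemma proj_line_scale: "c \<noteq> 0 \<Longrightarrow> proj_line (c *s a) = proj_line a"
  unfolding proj_line_def dotc_def[symmetric] by simp

lemma proj_line_Int:
  assumes "crossc a b \<noteq> 0"
  shows "proj_line a \<inter> proj_line b = {proj_point (crossc a b)}"
proof (intro equalityI subsetI)
  fix p assume p: "p \<in> proj_line a \<inter> proj_line b"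
  then obtain v where v: "v \<noteq> 0" "p = proj_point v" "dotc a v = 0" by (auto elim: proj_line_memE)
  then have "dotc b v = 0" using p by (simp add: mem_proj_line_iff)
  then obtain t where "v = t *s crossc a b" using orthogonal_crossc[OF v(3) _ assms] by blast
  moreover from this v(1) have "t \<noteq> 0" by auto
  ultimately show "p \<in> {proj_point (crossc a b)}" using v(2) by (auto simp: proj_point_eq_iff)
qed (use assms in \<open>auto simp: mem_proj_line_iff\<close>)

lemma curve_points_iff:
  assumes "v \<noteq> 0" "homogeneous_of_degree n F"
  shows "proj_point v \<in> curve_points (curve_of F) \<longleftrightarrow> cpoly_at F (($) v) = 0"
proof
  assume "proj_point v \<in> curve_points (curve_of F)"
  then obtain u c where u: "proj_point v = proj_point u" "c \<noteq> 0" "cpoly_at (cnst c * F) (($) u) = 0"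
    unfolding curve_points_def curve_of_altdef by auto
  then obtain d where "v = d *s u" by (auto simp: proj_point_eq_iff)
  then show "cpoly_at F (($) v) = 0" using u by (simp add: homogeneous_at_scale[OF assms(2)])
next
  assume "cpoly_at F (($) v) = 0"
  then show "proj_point v \<in> curve_points (curve_of F)"
    unfolding curve_points_def using assms(1) mem_curve_of by blast
qed

text \<open>Larger index first, so that each unordered pair of lines occurs once.\<close>

definition pair_set :: "nat \<Rightarrow> (nat \<times> nat) set" where
  "pair_set n = (SIGMA j:{..n}. {..<j})"

lemma finite_pair_set: "finite (pair_set n)"
  by (simp add: pair_set_def)

lemma card_pair_set: "card (pair_set n) = (n + 1) choose 2"
proof -
  have "card (pair_set n) = \<Sum>{0..n}" unfolding pair_set_def by (simp add: atMost_atLeast0)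
  also have "\<dots> = n * Suc n div 2" by (rule gauss_sum_nat)
  also have "\<dots> = (n + 1) choose 2" unfolding choose_two by (simp only: mult.commute diff_add_inverse2 Suc_eq_plus1)
  finally show ?thesis .
qed

definition vertex :: "(nat \<Rightarrow> complex ^ 3) \<Rightarrow> nat \<times> nat \<Rightarrow> point" where
  "vertex a = (\<lambda>(i, j). proj_point (crossc (a i) (a j)))"

lemma vertices_eq:
  assumes inj: "inj_on (\<lambda>i. proj_line (a i)) {..n}"
    and cr: "\<And>i j. i \<le> n \<Longrightarrow> j \<le> n \<Longrightarrow> i \<noteq> j \<Longrightarrow> crossc (a i) (a j) \<noteq> 0"
  shows "vertices ((\<lambda>i. proj_line (a i)) ` {..n}) = vertex a ` pair_set n"
proof -
  let ?l = "\<lambda>i. proj_line (a i)"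
  have int: "?l i \<inter> ?l j = {vertex a (i, j)}" if "i \<le> n" "j \<le> n" "i \<noteq> j" for i j
    using proj_line_Int[OF cr[OF that]] by (simp add: vertex_def)
  have neq: "?l i \<noteq> ?l j" if "i \<le> n" "j \<le> n" "i \<noteq> j" for i j
    using inj that by (auto dest: inj_onD)
  show ?thesis
  proof (intro equalityI subsetI)
    fix p assume "p \<in> vertices (?l ` {..n})"
    then obtain i j where ij: "i \<le> n" "j \<le> n" "?l i \<noteq> ?l j" "p \<in> ?l i \<inter> ?l j"
      unfolding vertices_def by auto
    then have "i \<noteq> j" by auto
    then consider "j < i" | "i < j" by linarith
    then show "p \<in> vertex a ` pair_set n"
    proof cases
      case 1
      then have "p = vertex a (i, j)" "(i, j) \<in> pair_set n" using int[of i j] ij by (auto simp: pair_set_def)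
      then show ?thesis by blast
    next
      case 2
      then have "p = vertex a (j, i)" "(j, i) \<in> pair_set n" using int[of j i] ij by (auto simp: pair_set_def)
      then show ?thesis by blast
    qed
  next
    fix p assume "p \<in> vertex a ` pair_set n"
    then obtain i j where ij: "i \<le> n" "j < i" "p = vertex a (i, j)" by (auto simp: pair_set_def)
    then have "p \<in> ?l i" "p \<in> ?l j" using int[of i j] by auto
    moreover have "?l j \<in> ?l ` {..n} - {?l i}" "?l i \<in> ?l ` {..n}" using neq[of j i] ij by auto
    ultimately show "p \<in> vertices (?l ` {..n})" unfolding vertices_def by blast
  qed
qed

text \<open>As many vertices as pairs means that distinct pairs have distinct vertices, whereas
  three concurrent lines would share one.\<close>

lemma gen_pos_of_vertices:
  assumes inj: "inj_on (\<lambda>i. proj_line (a i)) {..n}"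
    and cr: "\<And>i j. i \<le> n \<Longrightarrow> j \<le> n \<Longrightarrow> i \<noteq> j \<Longrightarrow> crossc (a i) (a j) \<noteq> 0"
    and card: "card (vertices ((\<lambda>i. proj_line (a i)) ` {..n})) = (n + 1) choose 2"
  shows "gen_pos n a"
  unfolding gen_pos_def
proof (intro allI impI, elim conjE, rule notI)
  fix i j k assume le: "i \<le> n" "j \<le> n" "k \<le> n" and d: "i \<noteq> j" "j \<noteq> k" "i \<noteq> k"
    and z: "det3 (a i) (a j) (a k) = 0"
  define s where "s i j = (max i j, min i j)" for i j :: nat
  have vs: "vertex a (s i j) = proj_point (crossc (a i) (a j))" if "i \<le> n" "j \<le> n" "i \<noteq> j" for i j
    using proj_line_Int[OF cr[OF that]] proj_line_Int[OF cr[OF that(2,1)]] that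
    by (auto simp: s_def vertex_def max_def min_def Int_commute)
  have eq: "vertices ((\<lambda>i. proj_line (a i)) ` {..n}) = vertex a ` pair_set n"
    by (rule vertices_eq[OF inj cr])
  have "inj_on (vertex a) (pair_set n)"
    using card unfolding eq
    by (intro eq_card_imp_inj_on finite_pair_set) (simp add: card_pair_set)
  moreover have "s i j \<in> pair_set n" "s j k \<in> pair_set n"
    using le d by (auto simp: s_def pair_set_def max_def min_def)
  moreover have "s i j \<noteq> s j k" using d by (auto simp: s_def max_def min_def split: if_splits)
  ultimately have "vertex a (s i j) \<noteq> vertex a (s j k)" by (auto dest: inj_onD)
  moreover have "proj_point (crossc (a j) (a k)) \<in> proj_line (a i) \<inter> proj_line (a j)"
    using z cr[of j k] le d by (simp add: mem_proj_line_iff det3_def)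
  ultimately show False
    using proj_line_Int[OF cr[of i j]] le d by (simp add: vs)
qed

lemma gen_pos_complete_polygon:
  assumes gp: "gen_pos n a" and n: "n \<ge> 2"
  shows "complete_polygon (n + 1) ((\<lambda>i. proj_line (a i)) ` {..n})"
    and "inj_on (\<lambda>i. proj_line (a i)) {..n}"
proof -
  let ?l = "\<lambda>i. proj_line (a i)"
  note cr = gen_pos_crossc_nonzero[OF gp n]
  show inj: "inj_on ?l {..n}"
  proof (rule inj_onI, rule ccontr)
    fix i j assume ij: "i \<in> {..n}" "j \<in> {..n}" "?l i = ?l j" "i \<noteq> j"
    obtain k where k: "k \<le> n" "k \<noteq> i" "k \<noteq> j" using third_index n by blast
    let ?p = "crossc (a i) (a k)"
    have nz: "?p \<noteq> 0" using ij k cr[of i k] by auto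
    then have "proj_point ?p \<in> ?l i" by (simp add: mem_proj_line_iff)
    then have "proj_point ?p \<in> ?l j" unfolding ij(3) .
    then have "dotc (a j) ?p = 0" using nz by (simp add: mem_proj_line_iff)
    then show False using gen_pos_vertex[OF gp, of i k j] ij k by auto
  qed
  have "inj_on (vertex a) (pair_set n)"
  proof (rule inj_onI, rule ccontr)
    fix p q assume pq: "p \<in> pair_set n" "q \<in> pair_set n" "vertex a p = vertex a q" "p \<noteq> q"
    obtain i j i' j' where eq: "p = (i, j)" "q = (i', j')" by (metis surj_pair)
    have ij: "i \<le> n" "j < i" "i' \<le> n" "j' < i'" using pq eq by (auto simp: pair_set_def)
    obtain c where c: "crossc (a i) (a j) = c *s crossc (a i') (a j')"
      using pq(3) eq by (auto simp: vertex_def proj_point_eq_iff)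
    have "dotc (a i') (crossc (a i) (a j)) = 0" "dotc (a j') (crossc (a i) (a j)) = 0"
      unfolding c by simp_all
    \<comment> \<open>Of two different pairs, the second has an index outside the first; that line
      would be a third one through the vertex.\<close>
    moreover have "(i' \<noteq> i \<and> i' \<noteq> j) \<or> (j' \<noteq> i \<and> j' \<noteq> j)" using ij pq(4) eq by auto
    ultimately show False using gen_pos_vertex[OF gp, of i j] ij by auto
  qed
  moreover have "vertices (?l ` {..n}) = vertex a ` pair_set n"
    by (rule vertices_eq[OF inj cr])
  ultimately have "card (vertices (?l ` {..n})) = (n + 1) choose 2"
    by (simp add: card_image card_pair_set)
  moreover have "?l ` {..n} \<subseteq> proj_lines"
    using gen_pos_nonzero[OF gp n] unfolding proj_lines_def by auto
  ultimately show "complete_polygon (n + 1) (?l ` {..n})"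
    using inj by (simp add: complete_polygon_def card_image)
qed

lemma inscribed_iff:
  assumes "gen_pos n a" "n \<ge> 2" "homogeneous_of_degree n F"
  shows "inscribed ((\<lambda>i. proj_line (a i)) ` {..n}) (curve_of F) \<longleftrightarrow>
    (\<forall>i\<le>n. \<forall>j\<le>n. i \<noteq> j \<longrightarrow> cpoly_at F (($) (crossc (a i) (a j))) = 0)" (is "?I \<longleftrightarrow> ?R")
proof -
  note cr = gen_pos_crossc_nonzero[OF assms(1,2)]
  have on: "vertex a (i, j) \<in> curve_points (curve_of F) \<longleftrightarrow> cpoly_at F (($) (crossc (a i) (a j))) = 0"
    if "i \<le> n" "j \<le> n" "i \<noteq> j" for i j
    using curve_points_iff[OF cr[OF that] assms(3)] by (simp add: vertex_def)
  have "vertices ((\<lambda>i. proj_line (a i)) ` {..n}) = vertex a ` pair_set n"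
    by (rule vertices_eq[OF gen_pos_complete_polygon(2)[OF assms(1,2)] cr])
  then have "?I \<longleftrightarrow> (\<forall>i j. (i, j) \<in> pair_set n \<longrightarrow> vertex a (i, j) \<in> curve_points (curve_of F))"
    by (auto simp: inscribed_def)
  also have "\<dots> \<longleftrightarrow> (\<forall>i j. (i, j) \<in> pair_set n \<longrightarrow> cpoly_at F (($) (crossc (a i) (a j))) = 0)"
    using on by (auto simp: pair_set_def)
  also have "\<dots> \<longleftrightarrow> ?R"
  proof
    assume L: "\<forall>i j. (i, j) \<in> pair_set n \<longrightarrow> cpoly_at F (($) (crossc (a i) (a j))) = 0"
    show ?R
    proof (intro allI impI)
      fix i j assume ij: "i \<le> n" "j \<le> n" "i \<noteq> j"
      have "(i, j) \<in> pair_set n \<or> (j, i) \<in> pair_set n" using ij by (auto simp: pair_set_def)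
      then consider "(i, j) \<in> pair_set n" | "(j, i) \<in> pair_set n" by blast
      then show "cpoly_at F (($) (crossc (a i) (a j))) = 0"
      proof cases
        case 2
        have eq: "crossc (a i) (a j) = (- 1) *s crossc (a j) (a i)"
          by (simp add: vec_eq_iff forall_3)
        show ?thesis unfolding eq homogeneous_at_scale[OF assms(3)] using L 2 by simp
      qed (use L in blast)
    qed
  qed (auto simp: pair_set_def)
  finally show ?thesis .
qed

text \<open>Every line has a nonzero coordinate, which is scaled to 1; its position
  \<open>\<kappa> i\<close> selects the chart.\<close>

lemma complete_polygon_param:
  assumes n: "n \<ge> 2" and poly: "complete_polygon (n + 1) L" and ins: "inscribed L (curve_of F)"
    and F: "homogeneous_of_degree n F"
  shows "\<exists>\<kappa> a c. (\<forall>i\<le>n. a i $ \<kappa> i = 1) \<and> L = (\<lambda>i. proj_line (a i)) ` {..n} \<and> gen_pos n a \<and> F = dform n a c"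
proof -
  have fin: "finite L" and card: "card L = n + 1" and lines: "L \<subseteq> proj_lines"
    and vert: "card (vertices L) = (n + 1) choose 2"
    using poly by (auto simp: complete_polygon_def)
  have "card {..n} = card L" using card by simp
  then obtain l where l: "bij_betw l {..n} L" using fin by (metis finite_atMost finite_same_card_bij)
  have "\<exists>b k. b $ k = 1 \<and> l i = proj_line b" if "i \<le> n" for i
  proof -
    have "l i \<in> proj_lines" using l lines that by (auto simp: bij_betw_def)
    then obtain b where b: "b \<noteq> 0" "l i = proj_line b" by (auto simp: proj_lines_def)
    then obtain k where k: "b $ k \<noteq> 0" by (auto simp: vec_eq_iff)
    then show ?thesis
      using b proj_line_scale[of "1 / b $ k" b]
      by (intro exI[of _ "(1 / b $ k) *s b"] exI[of _ k]) simp
  qed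
  then obtain a \<kappa> where a: "\<And>i. i \<le> n \<Longrightarrow> a i $ \<kappa> i = 1 \<and> l i = proj_line (a i)" by metis
  have L: "L = (\<lambda>i. proj_line (a i)) ` {..n}"
    using l a by (auto simp: bij_betw_def intro!: image_cong)
  have inj: "inj_on (\<lambda>i. proj_line (a i)) {..n}"
    using l a by (auto simp: bij_betw_def inj_on_def)
  have "crossc (a i) (a j) \<noteq> 0" if ij: "i \<le> n" "j \<le> n" "i \<noteq> j" for i j
  proof
    assume z: "crossc (a i) (a j) = 0"
    have nz: "a i \<noteq> 0" "a j \<noteq> 0" using a ij by (metis zero_index zero_neq_one)+
    then obtain t where t: "a j = t *s a i" using crossc_eq_zero[OF z] by blast
    then have "t \<noteq> 0" using nz by auto
    then have "proj_line (a j) = proj_line (a i)" unfolding t by (rule proj_line_scale)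
    then show False using inj ij by (auto dest: inj_onD)
  qed
  then have gp: "gen_pos n a" using inj vert unfolding L by (intro gen_pos_of_vertices) auto
  have "\<exists>c. F = dform n a c"
    using ins inscribed_iff[OF gp n F] unfolding L[symmetric]
    by (intro vanishing_at_vertices_imp_dform[OF gp n F]) auto
  then show ?thesis using a gp L by blast
qed

lemma dform_darboux:
  assumes "n \<ge> 2" "gen_pos n a" "dform n a c \<noteq> 0"
  shows "curve_of (dform n a c) \<in> darboux_curves n"
proof -
  have "inscribed ((\<lambda>i. proj_line (a i)) ` {..n}) (curve_of (dform n a c))"
    unfolding inscribed_iff[OF assms(2,1) homogeneous_dform]
    by (intro allI impI dform_at_vertex) auto
  then show ?thesis
    using gen_pos_complete_polygon(1)[OF assms(2,1)] homogeneous_dform assms(3)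
    unfolding darboux_curves_def plane_curves_def by blast
qed

lemma darboux_curvesE:
  assumes "n \<ge> 2" "C \<in> darboux_curves n"
  obtains a c where "gen_pos n a" "dform n a c \<noteq> 0" "C = curve_of (dform n a c)"
proof -
  obtain F L where "C = curve_of F" "homogeneous_of_degree n F" "F \<noteq> 0"
    "complete_polygon (n + 1) L" "inscribed L C"
    using assms(2) by (auto simp: darboux_curves_def plane_curves_def)
  then show thesis using complete_polygon_param[OF assms(1)] that by metis
qed

subsection \<open>Affine charts for polygons\<close>

text \<open>In the chart \<open>\<kappa>\<close> the \<open>\<kappa> i\<close>-th coordinate of the \<open>i\<close>-th line is 1; its slot stores the scalar \<open>c i\<close>.\<close>

definition chart_a :: "(nat \<Rightarrow> 3) \<Rightarrow> (nat \<Rightarrow> complex) \<Rightarrow> nat \<Rightarrow> complex ^ 3" where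
  "chart_a \<kappa> x i = (\<chi> k. if k = \<kappa> i then 1 else x (3 * i + idx k))"

definition chart_c :: "(nat \<Rightarrow> 3) \<Rightarrow> (nat \<Rightarrow> complex) \<Rightarrow> nat \<Rightarrow> complex" where
  "chart_c \<kappa> x i = x (3 * i + idx (\<kappa> i))"

lemma chart_exists:
  assumes "\<And>i. i \<le> n \<Longrightarrow> a i $ \<kappa> i = 1"
  shows "\<exists>x. \<forall>i\<le>n. chart_a \<kappa> x i = a i \<and> chart_c \<kappa> x i = c i"
proof -
  define x where "x q = (if coord (q mod 3) = \<kappa> (q div 3) then c (q div 3) else a (q div 3) $ coord (q mod 3))" for q
  have "chart_a \<kappa> x i = a i \<and> chart_c \<kappa> x i = c i" if "i \<le> n" for i
    using assms[OF that] by (simp add: chart_a_def chart_c_def x_def vec_eq_iff)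
  then show ?thesis by blast
qed

lemma dform_cong:
  "(\<And>i. i \<le> n \<Longrightarrow> a i = a' i \<and> c i = c' i) \<Longrightarrow> dform n a c = dform n a' c'"
  unfolding dform_def by (intro sum.cong prod.cong refl arg_cong2[of _ _ _ _ "(*)"] arg_cong[of _ _ cnst]
      arg_cong[of _ _ lform]) auto

text \<open>Each summand has exactly one factor per line, either \<open>c i\<close> or a linear
  form, and the parameter \<open>q\<close> occurs in the data of only one line.\<close>

lemma chart_polyd:
  "polyd 1 (\<lambda>s. cpoly_at (dform n (chart_a \<kappa> (x(q := s))) (chart_c \<kappa> (x(q := s)))) (($) v))"
proof -
  \<comment> \<open>The degree in parameter \<open>q\<close> that line \<open>j\<close>
    contributes.\<close>
  define \<delta> where "\<delta> j = (if q div 3 = j then 1 else 0 :: nat)" for j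
  have upd: "polyd (\<delta> j) (\<lambda>s. (x(q := s)) (3 * j + idx k))" for j k
  proof (cases "3 * j + idx k = q")
    case True
    then have "q div 3 = j" by auto
    then show ?thesis using True polyd_ident by (simp add: \<delta>_def)
  next
    case False
    then show ?thesis using polyd_mono[OF polyd_const] by simp
  qed
  have "polyd (\<delta> j) (\<lambda>s. dotc (chart_a \<kappa> (x(q := s)) j) v)" for j
    unfolding dotc_def
  proof (rule polyd_sum)
    fix k :: 3
    show "polyd (\<delta> j) (\<lambda>s. chart_a \<kappa> (x(q := s)) j $ k * v $ k)"
    proof (cases "k = \<kappa> j")
      case True
      then show ?thesis using polyd_mono[OF polyd_const] by (simp add: chart_a_def)
    next
      case False
      then have "(\<lambda>s. chart_a \<kappa> (x(q := s)) j $ k * v $ k) = (\<lambda>s. v $ k * (x(q := s)) (3 * j + idx k))"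
        by (simp add: chart_a_def mult.commute del: fun_upd_apply)
      then show ?thesis using polyd_cmult[OF upd] by simp
    qed
  qed
  moreover have "polyd (\<delta> i) (\<lambda>s. chart_c \<kappa> (x(q := s)) i)" for i
    unfolding chart_c_def by (rule upd)
  ultimately have summand: "polyd (\<delta> i + sum \<delta> ({..n} - {i}))
      (\<lambda>s. chart_c \<kappa> (x(q := s)) i * (\<Prod>j\<in>{..n} - {i}. dotc (chart_a \<kappa> (x(q := s)) j) v))" for i
    by (intro polyd_mult polyd_prod)
  have "\<delta> i + sum \<delta> ({..n} - {i}) \<le> 1" if "i \<le> n" for i
  proof -
    have "\<delta> i + sum \<delta> ({..n} - {i}) = sum \<delta> {..n}" using that by (simp add: sum.remove[of "{..n}" i \<delta>])
    also have "\<dots> \<le> 1" by (simp add: \<delta>_def)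
    finally show ?thesis .
  qed
  then show ?thesis
    unfolding cpoly_at_dform using summand by (intro polyd_sum) (meson atMost_iff polyd_mono)
qed

lemma chart_dep:
  assumes "\<forall>q<3 * (n + 1). x q = x' q"
  shows "dform n (chart_a \<kappa> x) (chart_c \<kappa> x) = dform n (chart_a \<kappa> x') (chart_c \<kappa> x')"
  using assms idx_bound by (intro dform_cong) (auto simp: chart_a_def chart_c_def vec_eq_iff)

text \<open>A single parameter and the \<open>K\<close> functionals are K + 1 functions of
  \<open>K\<close> parameters, so \<open>algebraic_relation\<close> applies. Equal forms have equal
  functionals.\<close>

lemma chart_relation:
  assumes L: "\<And>j. eval_comb (L j)" and q: "q < 3 * (n + 1)"
  shows "\<exists>P. polyfun P \<and> (\<forall>Y Y'. (\<forall>j<3 * (n + 1). Y j = Y' j) \<longrightarrow> P Y = P Y') \<and> (\<exists>Y. P Y \<noteq> 0) \<and>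
    (\<forall>F. P (\<lambda>j. L j (\<lambda>v. cpoly_at F (($) v))) \<noteq> 0 \<longrightarrow>
      finite {x q | x. dform n (chart_a \<kappa> x) (chart_c \<kappa> x) = F})"
proof -
  let ?y = "\<lambda>j x. L j (\<lambda>v. cpoly_at (dform n (chart_a \<kappa> x) (chart_c \<kappa> x)) (($) v))"
  have "\<exists>P. polyfun P \<and> (\<forall>Y Y'. (\<forall>j<3 * (n + 1). Y j = Y' j) \<longrightarrow> P Y = P Y') \<and> (\<exists>Y. P Y \<noteq> 0) \<and>
    (\<forall>Y. P Y \<noteq> 0 \<longrightarrow> finite {x q | x. \<forall>j<3 * (n + 1). ?y j x = Y j})"
  proof (rule algebraic_relation)
    show "polyd 1 (\<lambda>s. (x(i := s)) q)" for x :: "nat \<Rightarrow> complex" and i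
      using polyd_ident polyd_mono[OF polyd_const] by (cases "i = q") simp_all
    show "polyd 1 (\<lambda>s. ?y j (x(i := s)))" for j x i
      by (rule eval_comb_polyd[OF L]) (rule chart_polyd)
    show "?y j x = ?y j x'" if "\<forall>i<3 * (n + 1). x i = x' i" for j x x'
      using chart_dep[OF that, of \<kappa>] by simp
  qed (use q in auto)
  then obtain P where P: "polyfun P" "\<forall>Y Y'. (\<forall>j<3 * (n + 1). Y j = Y' j) \<longrightarrow> P Y = P Y'" "\<exists>Y. P Y \<noteq> 0"
    and fin: "\<And>Y. P Y \<noteq> 0 \<Longrightarrow> finite {x q | x. \<forall>j<3 * (n + 1). ?y j x = Y j}"
    by blast
  have "finite {x q | x. dform n (chart_a \<kappa> x) (chart_c \<kappa> x) = F}"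
    if "P (\<lambda>j. L j (\<lambda>v. cpoly_at F (($) v))) \<noteq> 0" for F
    by (rule finite_subset[OF _ fin[OF that]]) blast
  then show ?thesis using P by blast
qed

subsection \<open>Density of open sets of Darboux curves\<close>

text \<open>A univariate polynomial over the ring of ternary polynomials, evaluated at constants;
  its coefficients in each monomial are then polynomials in \<open>s\<close>.\<close>

definition polyp :: "(complex \<Rightarrow> 3 cpoly) \<Rightarrow> bool" where
  "polyp F \<longleftrightarrow> (\<exists>q. \<forall>s. F s = poly q (cnst s))"

lemma polyp_mult: "polyp F \<Longrightarrow> polyp G \<Longrightarrow> polyp (\<lambda>s. F s * G s)"
  unfolding polyp_def by (metis poly_mult)

lemma polyp_add: "polyp F \<Longrightarrow> polyp G \<Longrightarrow> polyp (\<lambda>s. F s + G s)"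
  unfolding polyp_def by (metis poly_add)

lemma polyp_const: "polyp (\<lambda>s. F)"
  unfolding polyp_def by (intro exI[of _ "[:F:]"]) simp

lemma polyp_sum: "(\<And>i. i \<in> I \<Longrightarrow> polyp (F i)) \<Longrightarrow> polyp (\<lambda>s. \<Sum>i\<in>I. F i s)"
  by (induction I rule: infinite_finite_induct) (auto intro: polyp_add polyp_const)

lemma polyp_prod: "(\<And>i. i \<in> I \<Longrightarrow> polyp (F i)) \<Longrightarrow> polyp (\<lambda>s. \<Prod>i\<in>I. F i s)"
  by (induction I rule: infinite_finite_induct) (auto intro: polyp_mult polyp_const)

lemma polyp_cnst_affine: "polyp (\<lambda>s. cnst (a + s * b))"
  unfolding polyp_def
  by (intro exI[of _ "[:cnst a, cnst b:]"]) (simp add: cnst_add cnst_mult)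

lemma polyp_lookup:
  assumes "polyp F" shows "polyc (\<lambda>s. Poly_Mapping.lookup (F s) m)"
proof -
  obtain q where q: "\<And>s. F s = poly q (cnst s)" using assms unfolding polyp_def by blast
  have "Poly_Mapping.lookup (F s) m = (\<Sum>i\<le>degree q. s ^ i * Poly_Mapping.lookup (coeff q i) m)" for s
    by (simp add: q poly_altdef lookup_sum cnst_power[symmetric] mult.commute[of "coeff q _"])
  then show ?thesis by (simp add: polyc_sum polyc_mult polyc_power polyc_ident polyc_const)
qed

lemma polyc_lookup_dform:
  "polyc (\<lambda>s. Poly_Mapping.lookup (dform n (\<lambda>j. a j + s *s m j) (\<lambda>j. c j + s * d j)) \<alpha>)"
  unfolding dform_def lform_def vector_add_component vector_smult_component
  by (intro polyp_lookup polyp_sum polyp_mult polyp_prod polyp_const polyp_cnst_affine)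

text \<open>Induction over the generation of open sets: intersections multiply the polynomials,
  unions keep one. Homogeneity makes a basic condition independent of the representative.\<close>

lemma zariski_open_nonvanishing:
  assumes "openin (zariski_curves n) U" "curve_of F \<in> U" "homogeneous_of_degree n F" "F \<noteq> 0"
  shows "\<exists>g. polyfun g \<and> g (Poly_Mapping.lookup F) \<noteq> 0 \<and>
    (\<forall>F'. homogeneous_of_degree n F' \<longrightarrow> F' \<noteq> 0 \<longrightarrow> g (Poly_Mapping.lookup F') \<noteq> 0 \<longrightarrow> curve_of F' \<in> U)"
proof -
  define good where "good g U \<longleftrightarrow> polyfun g \<and> g (Poly_Mapping.lookup F) \<noteq> 0 \<and>
    (\<forall>F'. homogeneous_of_degree n F' \<longrightarrow> F' \<noteq> 0 \<longrightarrow> g (Poly_Mapping.lookup F') \<noteq> 0 \<longrightarrow> curve_of F' \<in> U)" for g U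
  have "generate_topology_on {{curve_of F | F. homogeneous_of_degree n F \<and> F \<noteq> 0 \<and>
                       cpoly_at G (Poly_Mapping.lookup F) \<noteq> 0}
      | (d :: nat) (G :: (3 \<Rightarrow>\<^sub>0 nat) cpoly). homogeneous_of_degree d G} U"
    using assms(1) unfolding zariski_curves_def by (rule openin_topology_generated_by)
  then have "\<exists>g. good g U" using assms(2)
  proof (induction rule: generate_topology_on.induct)
    case (Int A B)
    then obtain f g where "good f A" "good g B" by blast
    then have "good (\<lambda>x. f x * g x) (A \<inter> B)" unfolding good_def by (auto intro: polyfun_mult)
    then show ?case by blast
  next
    case (UN K)
    then obtain A g where "A \<in> K" "good g A" by blast
    then have "good g (\<Union>K)" unfolding good_def by blast
    then show ?case by blast
  next
    case (Basis A)
    then obtain d G F0 where G: "homogeneous_of_degree d G"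
      and A: "A = {curve_of F | F. homogeneous_of_degree n F \<and> F \<noteq> 0 \<and> cpoly_at G (Poly_Mapping.lookup F) \<noteq> 0}"
      and F0: "curve_of F = curve_of F0" "cpoly_at G (Poly_Mapping.lookup F0) \<noteq> 0"
      by auto
    obtain c where c: "c \<noteq> 0" "F = cnst c * F0" using curve_of_eqD[OF F0(1)] by blast
    have "cpoly_at G (Poly_Mapping.lookup F) = c ^ d * cpoly_at G (Poly_Mapping.lookup F0)"
      using cpoly_at_scale[OF G, of c "Poly_Mapping.lookup F0"] unfolding c(2) lookup_cnst_mult[abs_def] .
    then have "cpoly_at G (Poly_Mapping.lookup F) \<noteq> 0" using c(1) F0(2) by simp
    then have "good (cpoly_at G) A" unfolding good_def A using polyfun_cpoly_at by blast
    then show ?case by blast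
  qed simp
  then show ?thesis unfolding good_def .
qed

text \<open>One good parameter suffices: from any Darboux curve, the line in the space of pairs (a,
  c) towards it meets every neighbourhood of that curve in good curves.\<close>

lemma holds_generically_darboux:
  assumes n: "n \<ge> 2" and f: "polyfun f"
    and a: "gen_pos n a1" and nz: "dform n a1 c1 \<noteq> 0" "f (Poly_Mapping.lookup (dform n a1 c1)) \<noteq> 0"
    and Q: "\<And>F. homogeneous_of_degree n F \<Longrightarrow> F \<noteq> 0 \<Longrightarrow> f (Poly_Mapping.lookup F) \<noteq> 0 \<Longrightarrow> Q (curve_of F)"
  shows "holds_generically (zariski_curves n) (darboux_curves n) Q"
proof -
  let ?T = "zariski_curves n" and ?D = "darboux_curves n"
  obtain N G where G: "\<And>r. homogeneous_of_degree r (G r)"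
    and fG: "\<And>x. f x = (\<Sum>r\<le>N. cpoly_at (G r) x)"
    using polyfun_homogeneous_parts[OF f] by blast
  \<comment> \<open>For inhomogeneous \<open>f\<close> the condition depends on the representative;
    \<open>U\<close> asks for some representative.\<close>
  define U where "U = {curve_of F | F. homogeneous_of_degree n F \<and> F \<noteq> 0 \<and> f (Poly_Mapping.lookup F) \<noteq> 0}"
  define B where "B r = {curve_of F | F. homogeneous_of_degree n F \<and> F \<noteq> 0 \<and> cpoly_at (G r) (Poly_Mapping.lookup F) \<noteq> 0}" for r
  have "U = (\<Union>r\<in>{..N}. B r)"
  proof (intro equalityI subsetI)
    fix C assume "C \<in> U"
    then obtain F where F: "C = curve_of F" "homogeneous_of_degree n F" "F \<noteq> 0" "f (Poly_Mapping.lookup F) \<noteq> 0"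
      by (auto simp: U_def)
    then obtain r where "r \<le> N" "cpoly_at (G r) (Poly_Mapping.lookup F) \<noteq> 0"
      unfolding fG by (metis (no_types, lifting) atMost_iff sum.neutral)
    then show "C \<in> (\<Union>r\<in>{..N}. B r)" using F by (auto simp: B_def)
  next
    fix C assume "C \<in> (\<Union>r\<in>{..N}. B r)"
    then obtain F r where F: "C = curve_of F" "homogeneous_of_degree n F" "F \<noteq> 0"
      and r: "r \<le> N" "cpoly_at (G r) (Poly_Mapping.lookup F) \<noteq> 0"
      by (auto simp: B_def)
    \<comment> \<open>Scaling the form by \<open>c\<close> weights the i-th part by
      \<open>c ^ i\<close>. One nonzero part gives a nonzero polynomial in \<open>c\<close>, hence a
      good representative.\<close>
    let ?p = "\<Sum>i\<le>N. monom (cpoly_at (G i) (Poly_Mapping.lookup F)) i"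
    have scaled: "f (Poly_Mapping.lookup (cnst c * F)) = poly ?p c" for c
      unfolding lookup_cnst_mult[abs_def] fG cpoly_at_scale[OF G] by (simp add: poly_sum poly_monom mult.commute)
    have "coeff ?p r = cpoly_at (G r) (Poly_Mapping.lookup F)" using r(1) by (simp add: coeff_sum)
    then have "?p \<noteq> 0" using r(2) by auto
    then have "finite {c. poly ?p c = 0}" by (rule poly_roots_finite)
    then obtain c where c: "c \<notin> insert 0 {c. poly ?p c = 0}"
      using ex_new_if_finite[of "insert 0 {c. poly ?p c = 0}"] infinite_UNIV_char_0 by blast
    have "homogeneous_of_degree n (cnst c * F)"
      using homogeneous_mult[OF homogeneous_cnst F(2), of c] by simp
    moreover have "f (Poly_Mapping.lookup (cnst c * F)) \<noteq> 0" using c unfolding scaled by simp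
    moreover have "cnst c * F \<noteq> 0"
    proof
      assume z: "cnst c * F = 0"
      have "F = cnst (1 / c) * (cnst c * F)"
        using c by (simp add: mult.assoc[symmetric] cnst_mult[symmetric] cnst_one)
      then show False using F(3) z by simp
    qed
    moreover have "C = curve_of (cnst c * F)" using c F(1) curve_of_cnst_mult[of c F] by simp
    ultimately show "C \<in> U" unfolding U_def by blast
  qed
  moreover have "openin ?T (B r)" for r
    unfolding zariski_curves_def B_def
    by (rule topology_generated_by_Basis) (use G in blast)
  ultimately have openU: "openin ?T U" by auto
  have "openin (subtopology ?T ?D) (?D \<inter> U)"
    using openU by (rule openin_subtopology_Int2)
  moreover have "subtopology ?T ?D closure_of (?D \<inter> U) = ?D"
  proof -
    have "\<exists>C. C \<in> ?D \<inter> U \<and> C \<in> V" if C0: "C0 \<in> ?D" "C0 \<in> V" and V: "openin ?T V" for C0 V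
    proof -
      obtain a0 c0 where a0: "gen_pos n a0" "dform n a0 c0 \<noteq> 0" "C0 = curve_of (dform n a0 c0)"
        using darboux_curvesE[OF n C0(1)] by blast
      obtain g where g: "polyfun g" "g (Poly_Mapping.lookup (dform n a0 c0)) \<noteq> 0"
        "\<And>F. homogeneous_of_degree n F \<Longrightarrow> F \<noteq> 0 \<Longrightarrow> g (Poly_Mapping.lookup F) \<noteq> 0 \<Longrightarrow> curve_of F \<in> V"
        using zariski_open_nonvanishing[OF V C0(2)[unfolded a0(3)] homogeneous_dform a0(2)] by blast
      define a where "a s j = a0 j + s *s (a1 j - a0 j)" for s j
      define c where "c s j = c0 j + s * (c1 j - c0 j)" for s j
      have at: "a 0 = a0" "c 0 = c0" "a 1 = a1" "c 1 = c1" by (auto simp: a_def c_def)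
      \<comment> \<open>A coefficient that is nonzero at the good end keeps the form from becoming
        zero along the line.\<close>
      obtain \<alpha> where \<alpha>: "Poly_Mapping.lookup (dform n a1 c1) \<alpha> \<noteq> 0"
        using nz(1) by (metis lookup_zero poly_mapping_eqI)
      have look: "polyc (\<lambda>s. Poly_Mapping.lookup (dform n (a s) (c s)) \<beta>)" for \<beta>
        unfolding a_def c_def by (rule polyc_lookup_dform)
      let ?I = "{\<lambda>s. f (Poly_Mapping.lookup (dform n (a s) (c s))), \<lambda>s. g (Poly_Mapping.lookup (dform n (a s) (c s))),
        \<lambda>s. Poly_Mapping.lookup (dform n (a s) (c s)) \<alpha>, \<lambda>s. gp_prod n (a s)}"
      have "\<exists>s. s \<notin> {} \<and> (\<forall>h\<in>?I. h s \<noteq> 0)"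
      proof (rule polyc_common_nonzero)
        have "polyc (\<lambda>s. gp_prod n (a s))" unfolding a_def by (rule polyc_gp_prod)
        moreover have "polyc (\<lambda>s. f (Poly_Mapping.lookup (dform n (a s) (c s))))"
          "polyc (\<lambda>s. g (Poly_Mapping.lookup (dform n (a s) (c s))))"
          by (rule polyfun_polyc[OF f look], rule polyfun_polyc[OF g(1) look])
        ultimately show "polyc h" if "h \<in> ?I" for h using that look by blast
        show "\<exists>s. h s \<noteq> 0" if "h \<in> ?I" for h
          using that nz(2) g(2) \<alpha> a[unfolded gen_pos_iff] at by (metis (no_types, lifting) empty_iff insert_iff)
      qed auto
      then obtain s where s: "f (Poly_Mapping.lookup (dform n (a s) (c s))) \<noteq> 0"
        "g (Poly_Mapping.lookup (dform n (a s) (c s))) \<noteq> 0"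
        "Poly_Mapping.lookup (dform n (a s) (c s)) \<alpha> \<noteq> 0" "gp_prod n (a s) \<noteq> 0" by auto
      have "dform n (a s) (c s) \<noteq> 0" using s(3) by auto
      then show ?thesis
        using s g(3)[OF homogeneous_dform] dform_darboux[OF n] homogeneous_dform
        unfolding U_def gen_pos_iff by blast
    qed
    then have dense: "\<exists>C. C \<in> ?D \<inter> U \<and> C \<in> W"
      if "C0 \<in> ?D" "C0 \<in> W" "openin (subtopology ?T ?D) W" for C0 W
      using that unfolding openin_subtopology by blast
    have "topspace (subtopology ?T ?D) = ?D"
      by (auto simp: topspace_zariski_curves darboux_curves_def)
    then have "?D \<subseteq> subtopology ?T ?D closure_of (?D \<inter> U)"
      unfolding subset_iff in_closure_of using dense by blast
    moreover have "subtopology ?T ?D closure_of (?D \<inter> U) \<subseteq> ?D"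
      using closure_of_subset_topspace[of "subtopology ?T ?D" "?D \<inter> U"] by auto
    ultimately show ?thesis by blast
  qed
  moreover have "\<forall>C\<in>?D \<inter> U. Q C" using Q unfolding U_def by blast
  ultimately show ?thesis unfolding holds_generically_def by blast
qed

subsection \<open>Finiteness\<close>

text \<open>An index set independent of the form shows that evaluation is polynomial in the
  coefficients.\<close>

lemma cpoly_at_homogeneous:
  fixes F :: "3 cpoly"
  assumes "homogeneous_of_degree n F"
  shows "cpoly_at F x = (\<Sum>m | mono_deg m = n. Poly_Mapping.lookup F m * mono_at m x)"
  using assms finite_ternary_monomials[of n]
  by (intro cpoly_at_superset) (auto simp: homogeneous_iff in_keys_iff)

lemma dform_one_nonzero:
  assumes "gen_pos n a" "n \<ge> 2" shows "dform n a (\<lambda>_. 1) \<noteq> 0"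
proof -
  obtain q where q: "dotc (a 0) q = 0" "\<And>j. j \<le> n \<Longrightarrow> j \<noteq> 0 \<Longrightarrow> dotc (a j) q \<noteq> 0"
    using points_on_line[OF assms, of 0] by blast
  have "(\<Prod>j\<in>{..n} - {0}. dotc (a j) q) \<noteq> 0" using q(2) by (auto simp: prod_zero_iff)
  then have "cpoly_at (dform n a (\<lambda>_. 1)) (($) q) \<noteq> 0"
    using dform_at_line[of 0 n a q "\<lambda>_. 1"] q(1) by simp
  then show ?thesis by auto
qed

lemma finite_vectors: 
  assumes "finite S" shows "finite {v :: complex ^ 3. \<forall>k. v $ k \<in> S}"
proof (rule finite_subset)
  show "{v :: complex ^ 3. \<forall>k. v $ k \<in> S} \<subseteq> (\<lambda>(x, y, z). vector [x, y, z]) ` (S \<times> S \<times> S)"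
  proof
    fix v :: "complex ^ 3" assume "v \<in> {v. \<forall>k. v $ k \<in> S}"
    moreover have "v = vector [v $ 1, v $ 2, v $ 3]" by (simp add: vec_eq_iff forall_3)
    ultimately show "v \<in> (\<lambda>(x, y, z). vector [x, y, z]) ` (S \<times> S \<times> S)"
      by (intro image_eqI[of _ _ "(v $ 1, v $ 2, v $ 3)"]) auto
  qed
qed (use assms in auto)

lemma finite_polygons:
  assumes n: "n \<ge> 2" and F: "homogeneous_of_degree n F"
    and fin: "\<And>\<kappa> q. \<kappa> \<in> PiE {..n} (\<lambda>_. UNIV) \<Longrightarrow> q < 3 * (n + 1) \<Longrightarrow>
      finite {x q | x. dform n (chart_a \<kappa> x) (chart_c \<kappa> x) = F}"
  shows "finite {L. complete_polygon (n + 1) L \<and> inscribed L (curve_of F)}"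
proof -
  \<comment> \<open>All line coordinates that can occur in any chart, including the normalized 1.
    Finitely many coordinates allow finitely many lines, hence polygons.\<close>
  define S where "S = insert 1 (\<Union>\<kappa>\<in>PiE {..n} (\<lambda>_. UNIV). \<Union>q<3 * (n + 1).
    {x q | x. dform n (chart_a \<kappa> x) (chart_c \<kappa> x) = F})"
  have "finite S" unfolding S_def using fin by (auto intro!: finite_PiE)
  then have "finite (Pow (proj_line ` {v. \<forall>k. v $ k \<in> S}))" using finite_vectors by blast
  moreover have "L \<in> Pow (proj_line ` {v. \<forall>k. v $ k \<in> S})"
    if L: "complete_polygon (n + 1) L" "inscribed L (curve_of F)" for L
  proof -
    obtain \<kappa>0 a c where a: "\<And>i. i \<le> n \<Longrightarrow> a i $ \<kappa>0 i = 1" and L: "L = (\<lambda>i. proj_line (a i)) ` {..n}"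
      and Fa: "F = dform n a c"
      using complete_polygon_param[OF n L F] by blast
    \<comment> \<open>Restriction makes the charts an extensional, hence finite, set.\<close>
    define \<kappa> where "\<kappa> = restrict \<kappa>0 {..n}"
    have \<kappa>: "\<kappa> \<in> PiE {..n} (\<lambda>_. UNIV)" by (simp add: \<kappa>_def)
    obtain x where x: "\<forall>i\<le>n. chart_a \<kappa> x i = a i \<and> chart_c \<kappa> x i = c i"
      using chart_exists[of n a \<kappa> c] a by (auto simp: \<kappa>_def)
    then have dx: "dform n (chart_a \<kappa> x) (chart_c \<kappa> x) = F" unfolding Fa by (intro dform_cong) auto
    have "a i $ k \<in> S" if i: "i \<le> n" for i k
    proof -
      have "a i $ k = chart_a \<kappa> x i $ k" using x i by simp
      then have "a i $ k = 1 \<or> a i $ k = x (3 * i + idx k)" by (simp add: chart_a_def)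
      then show ?thesis unfolding S_def using dx \<kappa> idx_bound[OF i, of k] by auto
    qed
    then show ?thesis unfolding L by auto
  qed
  ultimately show ?thesis by (elim finite_subset[rotated]) blast
qed

theorem corollary6p9:
  fixes n :: nat
  assumes "n \<ge> 5"
  shows "holds_generically (zariski_curves n) (darboux_curves n)
           (\<lambda>C. finite {L. complete_polygon (n + 1) L \<and> inscribed L C})"
proof -
  define K where "K = 3 * (n + 1)"
  have n2: "n \<ge> 2" using assms by simp
  obtain L where L: "\<And>j. eval_comb (L j)"
    and dom: "\<And>P. polyfun P \<Longrightarrow> (\<forall>Y Y'. (\<forall>j<K. Y j = Y' j) \<longrightarrow> P Y = P Y') \<Longrightarrow> (\<exists>Y. P Y \<noteq> 0) \<Longrightarrow>
      \<exists>a. gen_pos n a \<and> P (\<lambda>j. L j (\<lambda>v. cpoly_at (dform n a (\<lambda>_. 1)) (($) v))) \<noteq> 0"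
    using dform_dominant[OF assms] unfolding K_def by blast
  define X where "X = PiE {..n} (\<lambda>_. UNIV :: 3 set) \<times> {..<K}"
  have finX: "finite X" unfolding X_def by (auto intro!: finite_PiE)
  define R where "R p P \<longleftrightarrow> polyfun P \<and> (\<forall>Y Y'. (\<forall>j<K. Y j = Y' j) \<longrightarrow> P Y = P Y') \<and> (\<exists>Y. P Y \<noteq> 0) \<and>
    (\<forall>F. P (\<lambda>j. L j (\<lambda>v. cpoly_at F (($) v))) \<noteq> 0 \<longrightarrow>
      finite {x (snd p) | x. dform n (chart_a (fst p) x) (chart_c (fst p) x) = F})" for p P
  have "\<forall>p\<in>X. \<exists>P. R p P"
    using chart_relation[OF L] unfolding R_def X_def K_def by auto
  then obtain P where P: "\<And>p. p \<in> X \<Longrightarrow> R p (P p)" by metis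
  \<comment> \<open>The product makes all relations, for every chart and every parameter, nontrivial
    at once.\<close>
  define T where "T Y = (\<Prod>p\<in>X. P p Y)" for Y
  have "polyfun T" unfolding T_def using P by (intro polyfun_prod) (simp add: R_def)
  moreover have "\<forall>Y Y'. (\<forall>j<K. Y j = Y' j) \<longrightarrow> T Y = T Y'"
    unfolding T_def using P unfolding R_def by (auto intro!: prod.cong)
  moreover have "\<exists>Y. T Y \<noteq> 0"
    unfolding T_def using P finX by (intro polyfun_prod_nonzero) (auto simp: R_def)
  ultimately obtain a where a: "gen_pos n a" "T (\<lambda>j. L j (\<lambda>v. cpoly_at (dform n a (\<lambda>_. 1)) (($) v))) \<noteq> 0"
    using dom by blast
  \<comment> \<open>\<open>T\<close> rewritten as a polynomial in the coefficients of a form of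
    degree \<open>n\<close>.\<close>
  define f where "f w = T (\<lambda>j. L j (\<lambda>v. \<Sum>m | mono_deg m = n. w m * mono_at m (($) v)))"
    for w :: "(3 \<Rightarrow>\<^sub>0 nat) \<Rightarrow> complex"
  have fT: "f (Poly_Mapping.lookup F) = T (\<lambda>j. L j (\<lambda>v. cpoly_at F (($) v)))"
    if "homogeneous_of_degree n F" for F
    unfolding f_def cpoly_at_homogeneous[OF that] ..
  show ?thesis
  proof (rule holds_generically_darboux[where f = f, OF n2])
    show "polyfun f"
      unfolding f_def
      by (intro polyfun_compose[OF \<open>polyfun T\<close>] eval_comb_polyfun[OF L] polyfun_sum polyfun.intros)
    show "gen_pos n a" by (rule a)
    show "dform n a (\<lambda>_. 1) \<noteq> 0" by (rule dform_one_nonzero[OF a(1) n2])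
    show "f (Poly_Mapping.lookup (dform n a (\<lambda>_. 1))) \<noteq> 0"
      using a(2) unfolding fT[OF homogeneous_dform] .
  next
    fix F assume F: "homogeneous_of_degree n F" "f (Poly_Mapping.lookup F) \<noteq> 0"
    then have nz: "P p (\<lambda>j. L j (\<lambda>v. cpoly_at F (($) v))) \<noteq> 0" if "p \<in> X" for p
      using that finX unfolding fT[OF F(1)] T_def by (auto simp: prod_zero_iff)
    show "finite {L. complete_polygon (n + 1) L \<and> inscribed L (curve_of F)}"
    proof (rule finite_polygons[OF n2 F(1)])
      fix \<kappa> q assume "\<kappa> \<in> PiE {..n} (\<lambda>_. UNIV :: 3 set)" "q < 3 * (n + 1)"
      then have "(\<kappa>, q) \<in> X" by (simp add: X_def K_def)
      then show "finite {x q | x. dform n (chart_a \<kappa> x) (chart_c \<kappa> x) = F}"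
        using P[of "(\<kappa>, q)"] nz[of "(\<kappa>, q)"] unfolding R_def by simp
    qed
  qed
qed

end
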